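(* Let $r>0$, let $s\ge2$ be an integer, and let $a>1/2$. Put $n_\varepsilon:=n_\varepsilon(U^{r,a}(\mathbb T^s),L_2(\mathbb T^s))$. Then for every $\varepsilon\in(0,[a-1/2]^{-sr})$, $$n_\varepsilon\ \le\ \frac{2^s\varepsilon^{-1/r}\bigl(\ln\varepsilon^{-1/r}-s\ln(a-1/2)\bigr)^s}{(s-1)!\,\bigl(\ln\varepsilon^{-1/r}+s(1-\ln(a-1/2))-1\bigr)},$$ and for every $\varepsilon\in(0,[a+1/2]^{-sr})$, $$n_\varepsilon\ \ge\ \frac{2^s\varepsilon^{-1/r}\bigl(\ln\varepsilon^{-1/r}-s\ln(a+1/2)\bigr)^s}{(s-1)!\,\bigl(\ln\varepsilon^{-1/r}+s(1-\ln(a+1/2))\bigr)}-1.$$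
   Context: $\mathbb T^s=[-\pi,\pi]^s$ is the $s$-dimensional torus, and $L_2(\mathbb T^s)$ carries the inner product $(f,g)=(2\pi)^{-s}\int_{\mathbb T^s}f(\mathbf x)\overline{g(\mathbf x)}\,d\mathbf x$ and norm $\|f\|=(f,f)^{1/2}$. For $\mathbf k\in\mathbb Z^s$, $e_{\mathbf k}(\mathbf x)=e^{i(\mathbf k,\mathbf x)}$, $\hat f(\mathbf k)=(f,e_{\mathbf k})$. For $a>0$ put $\lambda_a(\mathbf k):=\prod_{j=1}^s(a+|k_j|)$. The modified Korobov space $K^{r,a}(\mathbb T^s)$ is the Hilbert space of all $f=\kappa_{r,a}*g$ with $g\in L_2(\mathbb T^s)$, where $\kappa_{r,a}=\sum_{\mathbf k\in\mathbb Z^s}\lambda_a(\mathbf k)^{-r}e_{\mathbf k}$ (in the distributional sense), i.e. $\hat f(\mathbf k)=\lambda_a(\mathbf k)^{-r}\hat g(\mathbf k)$, with norm $\|f\|_{K^{r,a}(\mathbb T^s)}:=\|g\|$; equivalently $\|f\|^2_{K^{r,a}(\mathbb T^s)}=\sum_{\mathbf k}\lambda_a(\mathbf k)^{2r}|\hat f(\mathbf k)|^2$. $U^{r,a}(\mathbb T^s)$ is its (closed) unit ball. For a normed space $X$ and $W\subset X$ centrally symmetric, $n_\varepsilon(W,X)$ is the smallest $n\in\mathbb N_0=\{0,1,2,\dots\}$ such that some linear subspace $L\subset X$ of dimension $\le n$ satisfies $\sup_{f\in W}\inf_{g\in L}\|f-g\|_X\le\varepsilon$. *)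

theory Defs
  imports "HOL-Analysis.Analysis"
begin

definition torus_measure :: "(real ^ 's::finite) measure" where
  "torus_measure = lebesgue_on (cbox (\<chi> j. - pi) (\<chi> j. pi))"

definition square_integrable :: "(real ^ 's::finite \<Rightarrow> complex) \<Rightarrow> bool" where
  "square_integrable f \<longleftrightarrow> f \<in> borel_measurable torus_measure \<and>
     integrable torus_measure (\<lambda>x. (cmod (f x))\<^sup>2)"

definition L2_rel :: "(real ^ 's::finite \<Rightarrow> complex) \<Rightarrow> (real ^ 's \<Rightarrow> complex) \<Rightarrow> bool" where
  "L2_rel f g \<longleftrightarrow> square_integrable f \<and> square_integrable g \<and> (AE x in torus_measure. f x = g x)"

lemma square_integrable_zero: "square_integrable (\<lambda>x. 0)"
  by (simp add: square_integrable_def)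

lemma square_integrable_scale:
  assumes "square_integrable f"
  shows "square_integrable (\<lambda>x. c * f x)"
  using assms by (auto simp: square_integrable_def norm_mult power_mult_distrib)

lemma square_integrable_uminus: "square_integrable f \<Longrightarrow> square_integrable (\<lambda>x. - f x)"
  using square_integrable_scale[of f "-1"] by simp

lemma square_integrable_mult_cnj:
  assumes "square_integrable f" "square_integrable g"
  shows "integrable torus_measure (\<lambda>x. f x * cnj (g x))"
proof (rule Bochner_Integration.integrable_bound)
  show "integrable torus_measure (\<lambda>x. (cmod (f x))\<^sup>2 + (cmod (g x))\<^sup>2)"
    using assms by (auto simp: square_integrable_def)
  have [measurable]: "f \<in> borel_measurable torus_measure" "g \<in> borel_measurable torus_measure"
    using assms by (auto simp: square_integrable_def)
  have "(\<lambda>x. cnj (g x)) \<in> borel_measurable torus_measure"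
    by (rule borel_measurable_continuous_on[OF continuous_on_cnj[OF continuous_on_id]]) measurable
  then show "(\<lambda>x. f x * cnj (g x)) \<in> borel_measurable torus_measure"
    by measurable
  have "a * b \<le> a\<^sup>2 + b\<^sup>2" if "0 \<le> a" "0 \<le> b" for a b :: real
    using sum_squares_bound[of a b] mult_nonneg_nonneg[OF that] by linarith
  then show "AE x in torus_measure. norm (f x * cnj (g x)) \<le> norm ((cmod (f x))\<^sup>2 + (cmod (g x))\<^sup>2)"
    by (intro AE_I2) (simp add: norm_mult)
qed

lemma square_integrable_add:
  assumes "square_integrable f" "square_integrable g"
  shows "square_integrable (\<lambda>x. f x + g x)"
proof -
  have [measurable]: "f \<in> borel_measurable torus_measure" "g \<in> borel_measurable torus_measure"
    using assms by (auto simp: square_integrable_def)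
  have "integrable torus_measure (\<lambda>x. (cmod (f x + g x))\<^sup>2)"
  proof (rule Bochner_Integration.integrable_bound)
    show "integrable torus_measure (\<lambda>x. 2 * (cmod (f x))\<^sup>2 + 2 * (cmod (g x))\<^sup>2)"
      using assms by (auto simp: square_integrable_def)
    show "(\<lambda>x. (cmod (f x + g x))\<^sup>2) \<in> borel_measurable torus_measure"
      by measurable
    have "(cmod (u + v))\<^sup>2 \<le> 2 * (cmod u)\<^sup>2 + 2 * (cmod v)\<^sup>2" for u v
    proof -
      have "(cmod (u + v))\<^sup>2 \<le> (cmod u + cmod v)\<^sup>2"
        by (intro power_mono norm_triangle_ineq) simp
      also have "\<dots> \<le> 2 * (cmod u)\<^sup>2 + 2 * (cmod v)\<^sup>2"
        using sum_squares_bound[of "cmod u" "cmod v"] by (simp add: power2_sum)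
      finally show ?thesis .
    qed
    then show "AE x in torus_measure.
        norm ((cmod (f x + g x))\<^sup>2) \<le> norm (2 * (cmod (f x))\<^sup>2 + 2 * (cmod (g x))\<^sup>2)"
      by (intro AE_I2) simp
  qed
  then show ?thesis
    by (simp add: square_integrable_def)
qed

lemma square_integrable_diff:
  "square_integrable f \<Longrightarrow> square_integrable g \<Longrightarrow> square_integrable (\<lambda>x. f x - g x)"
  using square_integrable_add[OF _ square_integrable_uminus, of f g] by simp

quotient_type (overloaded) 's L2 = "real ^ 's \<Rightarrow> complex" / partial: L2_rel
proof (rule part_equivpI)
  show "\<exists>f::real ^ 's \<Rightarrow> complex. L2_rel f f"
    using square_integrable_zero by (auto simp: L2_rel_def)
  show "symp L2_rel"
    by (auto simp: symp_def L2_rel_def)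
  show "transp L2_rel"
    by (auto simp: transp_def L2_rel_def)
qed

lift_definition L2_cinner :: "'s::finite L2 \<Rightarrow> 's L2 \<Rightarrow> complex" is
  "\<lambda>f g. (LINT x|torus_measure. f x * cnj (g x)) / (2 * complex_of_real pi) ^ CARD('s)"
proof -
  fix f f' g g' :: "real ^ 's \<Rightarrow> complex"
  assume *: "L2_rel f f'" "L2_rel g g'"
  then have i: "integrable torus_measure (\<lambda>x. f x * cnj (g x))"
    "integrable torus_measure (\<lambda>x. f' x * cnj (g' x))"
    by (auto simp: L2_rel_def intro: square_integrable_mult_cnj)
  have "AE x in torus_measure. f x * cnj (g x) = f' x * cnj (g' x)"
    using * by (auto simp: L2_rel_def)
  with i have "(LINT x|torus_measure. f x * cnj (g x)) = (LINT x|torus_measure. f' x * cnj (g' x))"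
    by (intro integral_cong_AE) auto
  then show "(LINT x|torus_measure. f x * cnj (g x)) / (2 * complex_of_real pi) ^ CARD('s) =
    (LINT x|torus_measure. f' x * cnj (g' x)) / (2 * complex_of_real pi) ^ CARD('s)"
    by simp
qed

lift_definition L2_scale :: "complex \<Rightarrow> 's::finite L2 \<Rightarrow> 's L2" is "\<lambda>c f x. c * f x"
  by (auto simp: L2_rel_def intro: square_integrable_scale)

instantiation L2 :: (finite) real_inner
begin

lift_definition zero_L2 :: "'a L2" is "\<lambda>x. 0"
  by (simp add: L2_rel_def square_integrable_zero)

lift_definition plus_L2 :: "'a L2 \<Rightarrow> 'a L2 \<Rightarrow> 'a L2" is "\<lambda>f g x. f x + g x"
  by (auto simp: L2_rel_def intro: square_integrable_add)

lift_definition minus_L2 :: "'a L2 \<Rightarrow> 'a L2 \<Rightarrow> 'a L2" is "\<lambda>f g x. f x - g x"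
  by (auto simp: L2_rel_def intro: square_integrable_diff)

lift_definition uminus_L2 :: "'a L2 \<Rightarrow> 'a L2" is "\<lambda>f x. - f x"
  by (auto simp: L2_rel_def intro: square_integrable_uminus)

definition scaleR_L2 :: "real \<Rightarrow> 'a L2 \<Rightarrow> 'a L2" where
  "scaleR_L2 c = L2_scale (complex_of_real c)"

definition inner_L2 :: "'a L2 \<Rightarrow> 'a L2 \<Rightarrow> real" where
  "inner_L2 f g = Re (L2_cinner f g)"

definition norm_L2 :: "'a L2 \<Rightarrow> real" where
  "norm_L2 f = sqrt (Re (L2_cinner f f))"

definition sgn_L2 :: "'a L2 \<Rightarrow> 'a L2" where
  "sgn_L2 f = inverse (norm f) *\<^sub>R f"

definition dist_L2 :: "'a L2 \<Rightarrow> 'a L2 \<Rightarrow> real" where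
  "dist_L2 f g = norm (f - g)"

definition uniformity_L2 :: "('a L2 \<times> 'a L2) filter" where
  "uniformity_L2 = (INF e\<in>{0<..}. principal {(f, g). dist f g < e})"

definition open_L2 :: "'a L2 set \<Rightarrow> bool" where
  "open_L2 S = (\<forall>f\<in>S. \<forall>\<^sub>F (f', g) in uniformity. f' = f \<longrightarrow> g \<in> S)"

lemmas square_integrable_intros = square_integrable_zero square_integrable_scale
  square_integrable_uminus square_integrable_add square_integrable_diff

lemma L2_scale_vector_space:
  "L2_scale c (f + g) = L2_scale c f + L2_scale c g"
  "L2_scale (c + d) f = L2_scale c f + L2_scale d f"
  "L2_scale c (L2_scale d f) = L2_scale (c * d) f"
  "L2_scale 1 f = f"
  for f g :: "'a L2"
  by (transfer; simp add: L2_rel_def algebra_simps square_integrable_intros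
      square_integrable_add[OF square_integrable_scale square_integrable_scale])+

lemma L2_cinner_self:
  "(\<exists>v\<ge>0. L2_cinner f f = complex_of_real v) \<and> (L2_cinner f f = 0 \<longleftrightarrow> f = 0)" for f :: "'a L2"
proof (transfer, goal_cases)
  case (1 f)
  then have f: "square_integrable f" by (simp add: L2_rel_def)
  have eq: "(LINT x|torus_measure. f x * cnj (f x)) / (2 * complex_of_real pi) ^ CARD('a) =
      complex_of_real ((LINT x|torus_measure. (cmod (f x))\<^sup>2) / (2 * pi) ^ CARD('a))"
    by (simp only: complex_norm_square[symmetric] integral_complex_of_real[symmetric] of_real_divide
        of_real_power of_real_mult of_real_numeral)
  have "(LINT x|torus_measure. (cmod (f x))\<^sup>2) = 0 \<longleftrightarrow> (AE x in torus_measure. f x = 0)"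
    using f by (subst integral_nonneg_eq_0_iff_AE) (auto simp: square_integrable_def)
  moreover have "(LINT x|torus_measure. (cmod (f x))\<^sup>2) \<ge> 0"
    by (rule integral_nonneg_AE) simp
  ultimately show ?case
    unfolding eq using f
    by (auto simp: L2_rel_def square_integrable_zero intro!: exI[of _ "(LINT x|torus_measure. (cmod (f x))\<^sup>2) / (2 * pi) ^ CARD('a)"])
qed

lemma L2_cinner_cnj: "L2_cinner f g = cnj (L2_cinner g f)" for f g :: "'a L2"
proof (transfer, goal_cases)
  case (1 f g)
  have "cnj (LINT x|torus_measure. g x * cnj (f x)) = (LINT x|torus_measure. cnj (g x * cnj (f x)))"
    by (simp del: complex_cnj_mult)
  then show ?case by (simp add: mult.commute)
qed

lemma L2_cinner_add_left: "L2_cinner (f + g) h = L2_cinner f h + L2_cinner g h" for f g h :: "'a L2"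
  by transfer (simp add: L2_rel_def distrib_right square_integrable_mult_cnj add_divide_distrib)

lemma L2_cinner_scale_left: "L2_cinner (L2_scale c f) g = c * L2_cinner f g" for f g :: "'a L2"
  by transfer (simp add: mult.assoc)

instance
proof
  fix f g h :: "'a L2" and c d :: real
  show "f + g + h = f + (g + h)" "f + g = g + f" "0 + f = f" "- f + f = 0" "f - g = f + - g"
    by (transfer; simp add: L2_rel_def algebra_simps square_integrable_intros)+
  show "c *\<^sub>R (f + g) = c *\<^sub>R f + c *\<^sub>R g" "(c + d) *\<^sub>R f = c *\<^sub>R f + d *\<^sub>R f"
    "c *\<^sub>R d *\<^sub>R f = (c * d) *\<^sub>R f" "1 *\<^sub>R f = f"
    by (simp_all add: scaleR_L2_def L2_scale_vector_space)
  show "sgn f = inverse (norm f) *\<^sub>R f" by (fact sgn_L2_def)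
  show "dist f g = norm (f - g)" by (fact dist_L2_def)
  show "norm f = sqrt (inner f f)" by (simp add: norm_L2_def inner_L2_def)
  show "inner f g = inner g f" using L2_cinner_cnj[of f g] by (simp add: inner_L2_def)
  show "inner (f + g) h = inner f h + inner g h" by (simp add: inner_L2_def L2_cinner_add_left)
  show "inner (c *\<^sub>R f) g = c * inner f g"
    by (simp add: inner_L2_def scaleR_L2_def L2_cinner_scale_left)
  show "0 \<le> inner f f" "(inner f f = 0) = (f = 0)"
    using L2_cinner_self[of f] by (auto simp: inner_L2_def)
qed (simp_all add: uniformity_L2_def open_L2_def)

end

lemma vector_space_L2_scale: "vector_space (L2_scale :: complex \<Rightarrow> 's::finite L2 \<Rightarrow> 's L2)"
  by unfold_locales (simp_all add: L2_scale_vector_space)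

lemma exp_square_integrable: 
  "square_integrable (\<lambda>x :: real ^ 's::finite. cis (\<Sum>j\<in>UNIV. of_int (k $ j) * x $ j))"
proof -
  have "continuous_on UNIV (\<lambda>x :: real ^ 's. cis (\<Sum>j\<in>UNIV. of_int (k $ j) * x $ j))"
    by (intro continuous_intros)
  then have "(\<lambda>x :: real ^ 's. cis (\<Sum>j\<in>UNIV. of_int (k $ j) * x $ j)) \<in> borel_measurable borel"
    by (rule borel_measurable_continuous_onI)
  then have "(\<lambda>x :: real ^ 's. cis (\<Sum>j\<in>UNIV. of_int (k $ j) * x $ j)) \<in> borel_measurable torus_measure"
    unfolding torus_measure_def
    by (intro measurable_restrict_space1 measurable_completion) simp
  moreover have "integrable torus_measure (\<lambda>x :: real ^ 's. 1 :: real)"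
    unfolding torus_measure_def
    by (rule finite_measure.integrable_const, rule finite_measure_lebesgue_on) auto
  ultimately show ?thesis
    by (simp add: square_integrable_def)
qed

lift_definition L2_exp :: "int ^ 's::finite \<Rightarrow> 's L2" is
  "\<lambda>k x. cis (\<Sum>j\<in>UNIV. of_int (k $ j) * x $ j)"
  by (simp add: L2_rel_def exp_square_integrable)

definition fourier_coeff :: "'s::finite L2 \<Rightarrow> int ^ 's \<Rightarrow> complex" where
  "fourier_coeff f k = L2_cinner f (L2_exp k)"

definition korobov_weight :: "real \<Rightarrow> int ^ 's::finite \<Rightarrow> real" where
  "korobov_weight a k = (\<Prod>j\<in>UNIV. a + \<bar>of_int (k $ j)\<bar>)"

text \<open>The equation \<open>f = \<kappa>\<^bsub>r,a\<^esub> * g\<close>, read through Fourier coefficients, as \<open>\<kappa>\<^bsub>r,a\<^esub>\<close> is in general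
  only a distribution.\<close>

definition korobov_convolution :: "real \<Rightarrow> real \<Rightarrow> 's::finite L2 \<Rightarrow> 's L2 \<Rightarrow> bool" where
  "korobov_convolution r a f g \<longleftrightarrow>
     (\<forall>k. fourier_coeff f k = of_real (korobov_weight a k powr (- r)) * fourier_coeff g k)"

definition korobov_space :: "real \<Rightarrow> real \<Rightarrow> 's::finite L2 set" where
  "korobov_space r a = {f. \<exists>g. korobov_convolution r a f g}"

text \<open>For \<open>a > 0\<close> the weights are nonzero, so that \<open>f\<close> determines all Fourier coefficients of \<open>g\<close>,
  hence (by completeness of the trigonometric system) \<open>g\<close> itself.\<close>

definition korobov_norm :: "real \<Rightarrow> real \<Rightarrow> 's::finite L2 \<Rightarrow> real" where
  "korobov_norm r a f = norm (THE g. korobov_convolution r a f g)"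

definition korobov_ball :: "real \<Rightarrow> real \<Rightarrow> 's::finite L2 set" where
  "korobov_ball r a = {f \<in> korobov_space r a. korobov_norm r a f \<le> 1}"

text \<open>The scalar multiplication is a parameter, because the dimension of subspaces of \<open>L\<^sub>2\<close>
  is taken over the complex numbers.  "Dimension at most \<open>n\<close>" is expressed by a spanning set, as
  \<^const>\<open>vector_space.dim\<close> is \<open>0\<close> on infinite-dimensional spaces.  The value is \<open>\<infinity>\<close> if no \<open>n\<close>
  has the required property.\<close>

definition n_eps :: "('k::field \<Rightarrow> 'a::real_normed_vector \<Rightarrow> 'a) \<Rightarrow> real \<Rightarrow> 'a set \<Rightarrow> enat" where
  "n_eps smul \<epsilon> W = Inf {enat n | n. \<exists>L.
     (\<exists>B. finite B \<and> card B \<le> n \<and> L = module.span smul B) \<and>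
     (SUP f\<in>W. INF g\<in>L. ennreal (norm (f - g))) \<le> ennreal \<epsilon>}"

end

theory Submission
  imports Defs
begin

text \<open>With \<open>T = \<epsilon> powr (-1/r)\<close>, the number \<open>n\<^sub>\<epsilon>\<close> equals the number of lattice points \<open>k\<close> with
  \<open>\<lambda>\<^sub>a(k) < T\<close>. Truncating the Fourier series to these frequencies gives the upper estimate, by Parseval;
  for a subspace of smaller dimension, a trigonometric polynomial with these frequencies that is
  orthogonal to it gives the lower estimate. The number of lattice points is compared with the volume of
  \<open>{x. \<Prod>\<^sub>j (a \<mp> 1/2 + \<bar>x\<^sub>j\<bar>) < T}\<close> by rounding each coordinate to the nearest integer. Substituting
  logarithms, for \<open>b = a \<mp> 1/2\<close> and \<open>\<tau> = ln (T / b\<^sup>s)\<close> that volume is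
  \<open>(2 b)\<^sup>s / (s - 1)!\<close> times the integral of \<open>t\<^sup>s\<^sup>-\<^sup>1 e\<^sup>t\<close> over \<open>[0, \<tau>]\<close>, which lies between
  \<open>e\<^sup>\<tau> \<tau>\<^sup>s / (\<tau> + s)\<close> and \<open>e\<^sup>\<tau> \<tau>\<^sup>s / (\<tau> + s - 1)\<close>, as comparing derivatives in \<open>\<tau>\<close> shows.\<close>

subsection \<open>The region of bounded products\<close>

text \<open>For \<open>n \<ge> 1\<close> the integral of \<open>u\<^sup>n\<^sup>-\<^sup>1 e\<^sup>u / (n - 1)!\<close> over \<open>[0, t]\<close>; the recursion is integration
  by parts.\<close>

primrec hyp_integral :: "nat \<Rightarrow> real \<Rightarrow> real" where
  "hyp_integral 0 t = 1"
| "hyp_integral (Suc n) t = exp t * t ^ n / fact n - hyp_integral n t"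

text \<open>The constant 1 for \<open>n = 0\<close> is the volume of a one-point space. It also
  starts the recursion correctly: for \<open>n = 1\<close> the result is \<open>exp t - 1\<close>,
  the integral of \<open>exp\<close> over \<open>[0, t]\<close>.\<close>

lemma hyp_integral_zero: "hyp_integral n 0 = (if n = 0 then 1 else 0)"
  by (induction n) auto

text \<open>The product rule splits the derivative of \<open>exp t * t ^ n / fact n\<close> into the
  wanted integrand and the one of the preceding index; by induction the latter cancels against the
  derivative of \<open>hyp_integral n\<close>.\<close>

lemma DERIV_hyp_integral:
  "(hyp_integral n has_real_derivative (if n = 0 then 0 else exp t * t ^ (n - 1) / fact (n - 1))) (at t)"
proof (induction n)
  case 0
  show ?case by simp
next
  case (Suc n)
  have "((\<lambda>t. exp t * t ^ n / fact n - hyp_integral n t) has_real_derivative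
      exp t * t ^ n / fact n + exp t * (real n * t ^ (n - 1)) / fact n -
        (if n = 0 then 0 else exp t * t ^ (n - 1) / fact (n - 1))) (at t)"
    using DERIV_diff[OF DERIV_cdivide[OF DERIV_mult[OF DERIV_exp DERIV_pow[of n t]], of "fact n"] Suc]
    by (simp add: add_divide_distrib mult_ac add_ac)
  moreover have "exp t * (real n * t ^ (n - 1)) / fact n =
      (if n = 0 then 0 else exp t * t ^ (n - 1) / fact (n - 1))"
    by (cases n) (simp_all add: field_simps del: of_nat_Suc)
  ultimately show ?case by simp
qed

lemma hyp_integral_mono:
  assumes "0 \<le> t" "t \<le> u"
  shows "hyp_integral n t \<le> hyp_integral n u"
proof (rule DERIV_nonneg_imp_nondecreasing[OF assms(2)])
  fix x assume "t \<le> x" "x \<le> u"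
  then have "0 \<le> x" using assms by simp
  then show "\<exists>y. (hyp_integral n has_real_derivative y) (at x) \<and> 0 \<le> y"
    by (intro exI[of _ "if n = 0 then 0 else exp x * x ^ (n - 1) / fact (n - 1)"] conjI
        DERIV_hyp_integral) simp
qed

lemma hyp_integral_nonneg: "0 \<le> t \<Longrightarrow> 0 \<le> hyp_integral n t"
  using hyp_integral_mono[of 0 t n] by (auto simp: hyp_integral_zero split: if_splits)

text \<open>Both sides vanish at 0, so it is enough to compare derivatives. With
  \<open>c = n - 1\<close> the numerator \<open>(x + n) * (x + c) - x\<close> equals
  \<open>(x + c)^2 + c\<close>, so the bound grows at least as fast as the integral. For
  \<open>n \<ge> 2\<close> its denominator is nonzero on all of \<open>[0, t]\<close>.\<close>

lemma hyp_integral_upper: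
  assumes "0 \<le> t" "n \<ge> 2"
  shows "hyp_integral n t \<le> exp t * t ^ n / (fact (n - 1) * (t + real n - 1))"
proof -
  define c where "c = real n - 1"
  define F where "F = (\<lambda>t. exp t * t ^ n / (fact (n - 1) * (t + c)))"
  have c: "c \<ge> 1" using assms by (simp add: c_def)
  have "\<exists>y. ((\<lambda>t. F t - hyp_integral n t) has_real_derivative y) (at x) \<and> 0 \<le> y" if "0 \<le> x" for x
  proof (intro exI conjI)
    have x: "x + c \<noteq> 0" using that c by simp
    have p: "x ^ n = x * x ^ (n - 1)" using assms by (cases n) auto
    have "(F has_real_derivative exp x * x ^ (n - 1) * ((x + real n) * (x + c) - x) / (fact (n - 1) * (x + c)\<^sup>2)) (at x)"
      unfolding F_def
      using x by (auto intro!: derivative_eq_intros simp: divide_simps)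
        (simp add: algebra_simps power2_eq_square p)
    from DERIV_diff[OF this DERIV_hyp_integral, of n]
    show "((\<lambda>t. F t - hyp_integral n t) has_real_derivative
        exp x * x ^ (n - 1) * ((x + real n) * (x + c) - x) / (fact (n - 1) * (x + c)\<^sup>2) -
        exp x * x ^ (n - 1) / fact (n - 1)) (at x)"
      using assms by simp
    have "(x + real n) * (x + c) - x = (x + c)\<^sup>2 + c"
      by (simp add: c_def power2_eq_square algebra_simps)
    then have "exp x * x ^ (n - 1) * ((x + real n) * (x + c) - x) / (fact (n - 1) * (x + c)\<^sup>2) -
        exp x * x ^ (n - 1) / fact (n - 1) = exp x * x ^ (n - 1) * c / (fact (n - 1) * (x + c)\<^sup>2)"
      using x by (simp add: field_simps)
    also have "\<dots> \<ge> 0" using that c by simp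
    finally show "0 \<le> exp x * x ^ (n - 1) * ((x + real n) * (x + c) - x) / (fact (n - 1) * (x + c)\<^sup>2) -
        exp x * x ^ (n - 1) / fact (n - 1)" .
  qed
  then have "F 0 - hyp_integral n 0 \<le> F t - hyp_integral n t"
    by (intro DERIV_nonneg_imp_nondecreasing[OF assms(1)]) auto
  moreover have "F 0 = 0" "hyp_integral n 0 = 0"
    using assms by (simp_all add: F_def hyp_integral_zero)
  ultimately have "hyp_integral n t \<le> F t" by linarith
  then show ?thesis
    by (simp add: F_def c_def add_diff_eq)
qed

text \<open>The same comparison with \<open>n\<close> in place of \<open>n - 1\<close> in the
  denominator: the numerator is now \<open>(x + n)^2 - x\<close>, so the bound grows no faster than
  the integral.\<close>

lemma hyp_integral_lower:
  assumes "0 \<le> t" "n \<ge> 1"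
  shows "exp t * t ^ n / (fact (n - 1) * (t + real n)) \<le> hyp_integral n t"
proof -
  define F where "F = (\<lambda>t. exp t * t ^ n / (fact (n - 1) * (t + real n)))"
  have "\<exists>y. ((\<lambda>t. hyp_integral n t - F t) has_real_derivative y) (at x) \<and> 0 \<le> y" if "0 \<le> x" for x
  proof (intro exI conjI)
    have x: "x + real n \<noteq> 0" using that assms by simp
    have p: "x ^ n = x * x ^ (n - 1)" using assms by (cases n) auto
    have "(F has_real_derivative exp x * x ^ (n - 1) * ((x + real n)\<^sup>2 - x) / (fact (n - 1) * (x + real n)\<^sup>2)) (at x)"
      unfolding F_def
      using x by (auto intro!: derivative_eq_intros simp: divide_simps)
        (simp add: algebra_simps power2_eq_square p)
    from DERIV_diff[OF DERIV_hyp_integral this, of n]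
    show "((\<lambda>t. hyp_integral n t - F t) has_real_derivative exp x * x ^ (n - 1) / fact (n - 1) -
        exp x * x ^ (n - 1) * ((x + real n)\<^sup>2 - x) / (fact (n - 1) * (x + real n)\<^sup>2)) (at x)"
      using assms by simp
    have "exp x * x ^ (n - 1) / fact (n - 1) -
        exp x * x ^ (n - 1) * ((x + real n)\<^sup>2 - x) / (fact (n - 1) * (x + real n)\<^sup>2) =
        exp x * x ^ (n - 1) * x / (fact (n - 1) * (x + real n)\<^sup>2)"
      using x by (simp add: field_simps)
    also have "\<dots> \<ge> 0" using that by simp
    finally show "0 \<le> exp x * x ^ (n - 1) / fact (n - 1) -
        exp x * x ^ (n - 1) * ((x + real n)\<^sup>2 - x) / (fact (n - 1) * (x + real n)\<^sup>2)" .
  qed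
  then have "hyp_integral n 0 - F 0 \<le> hyp_integral n t - F t"
    by (intro DERIV_nonneg_imp_nondecreasing[OF assms(1)]) auto
  moreover have "F 0 = 0" "hyp_integral n 0 = 0"
    using assms by (simp_all add: F_def hyp_integral_zero)
  ultimately have "F t \<le> hyp_integral n t" by linarith
  then show ?thesis
    by (simp add: F_def)
qed

text \<open>The volume of the set of all \<open>x \<in> \<real>\<^sup>n\<close> with \<open>\<Prod>\<^sub>j (b + \<bar>x\<^sub>j\<bar>) < T\<close>.\<close>

definition hyp_volume :: "real \<Rightarrow> nat \<Rightarrow> real \<Rightarrow> real" where
  "hyp_volume b n T = (if b ^ n < T then (2 * b) ^ n * hyp_integral n (ln T - real n * ln b) else 0)"

text \<open>Up to the threshold \<open>b ^ n\<close> the value is 0; beyond it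
  \<open>ln T - n * ln b\<close> is positive and the value is nonnegative and nondecreasing.\<close>

lemma hyp_volume_mono:
  assumes b: "0 < b" and "T \<le> U"
  shows "hyp_volume b n T \<le> hyp_volume b n U"
proof -
  have pos: "0 < ln T - real n * ln b" if "b ^ n < T" for T
  proof -
    have "0 < b ^ n" using b by simp
    then have "ln (b ^ n) < ln T" using that by (subst ln_less_cancel_iff) linarith+
    then show ?thesis using b by (simp add: ln_realpow)
  qed
  consider "b ^ n < T" | "\<not> b ^ n < T" "b ^ n < U" | "\<not> b ^ n < T" "\<not> b ^ n < U" by blast
  then show ?thesis
  proof cases
    case 1
    have "0 < T" using 1 b zero_less_power[of b n] by linarith
    have "b ^ n < U" using 1 assms(2) by simp
    moreover have "ln T \<le> ln U" using \<open>0 < T\<close> assms(2) by simp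
    ultimately show ?thesis
      unfolding hyp_volume_def
      using 1 pos[OF 1] b by (auto intro!: mult_left_mono hyp_integral_mono)
  next
    case 2
    then show ?thesis
      using pos[OF 2(2)] b by (simp add: hyp_volume_def hyp_integral_nonneg)
  next
    case 3
    then show ?thesis by (simp add: hyp_volume_def)
  qed
qed

lemma hyp_volume_measurable [measurable]: "hyp_volume b n \<in> borel_measurable borel"
proof -
  have "continuous_on UNIV (hyp_integral n)"
    by (intro continuous_at_imp_continuous_on ballI DERIV_isCont[OF DERIV_hyp_integral])
  then have [measurable]: "hyp_integral n \<in> borel_measurable borel"
    by (rule borel_measurable_continuous_onI)
  show ?thesis unfolding hyp_volume_def by measurable
qed

section \<open>Slicing the volume along one coordinate\<close>

lemma nn_integral_even:
  fixes f :: "real \<Rightarrow> ennreal"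
  assumes [measurable]: "f \<in> borel_measurable borel"
  shows "(\<integral>\<^sup>+x. f \<bar>x\<bar> \<partial>lborel) = 2 * (\<integral>\<^sup>+x. f x * indicator {0..} x \<partial>lborel)"
proof -
  have "(\<integral>\<^sup>+x. f \<bar>x\<bar> \<partial>lborel) = (\<integral>\<^sup>+x. f \<bar>x\<bar> * indicator {0..} x + f \<bar>x\<bar> * indicator {..0} x \<partial>lborel)"
  proof (rule nn_integral_cong_AE)
    show "AE x in lborel. f \<bar>x\<bar> = f \<bar>x\<bar> * indicator {0..} x + f \<bar>x\<bar> * indicator {..0} x"
      \<comment> \<open>The two half-lines overlap in 0 only, which is a null set.\<close>
      using AE_lborel_singleton[of 0] by eventually_elim (auto simp: indicator_def)
  qed
  also have "\<dots> = (\<integral>\<^sup>+x. f \<bar>x\<bar> * indicator {0..} x \<partial>lborel) + (\<integral>\<^sup>+x. f \<bar>x\<bar> * indicator {..0} x \<partial>lborel)"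
    by (rule nn_integral_add) measurable
  also have "(\<integral>\<^sup>+x. f \<bar>x\<bar> * indicator {..0} x \<partial>lborel) = (\<integral>\<^sup>+x. f \<bar>x\<bar> * indicator {0..} x \<partial>lborel)"
    by (subst nn_integral_real_affine[where c = "-1" and t = 0])
      (auto simp: indicator_def intro!: nn_integral_cong)
  also have "(\<integral>\<^sup>+x. f \<bar>x\<bar> * indicator {0..} x \<partial>lborel) = (\<integral>\<^sup>+x. f x * indicator {0..} x \<partial>lborel)"
    by (intro nn_integral_cong) (auto simp: indicator_def)
  finally show ?thesis by (simp add: mult_2)
qed

text \<open>Fixing one coordinate \<open>x\<close> leaves a region of one dimension less with bound
  \<open>T / (b + |x|)\<close>. The later inductions over coordinates know the volume only through
  this recursion, its monotonicity and its value in dimension 0.\<close>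

lemma hyp_volume_Suc:
  assumes b: "0 < b"
  shows "(\<integral>\<^sup>+x. ennreal (hyp_volume b n (T / (b + \<bar>x\<bar>))) \<partial>lborel) = ennreal (hyp_volume b (Suc n) T)"
proof (cases "b ^ Suc n < T")
  case False
  have "hyp_volume b n (T / (b + \<bar>x\<bar>)) = 0" for x
  proof -
    have "T \<le> b ^ n * b" using False by (simp add: mult.commute)
    also have "\<dots> \<le> b ^ n * (b + \<bar>x\<bar>)" using b by (intro mult_left_mono) auto
    finally have "T / (b + \<bar>x\<bar>) \<le> b ^ n" using b by (subst pos_divide_le_eq) auto
    then show ?thesis by (simp add: hyp_volume_def)
  qed
  then show ?thesis using False by (simp add: hyp_volume_def)
next
  case True
  have bn: "0 < b ^ n" using b by simp
  have T: "0 < T" using True b zero_less_power[of b "Suc n"] by linarith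
  \<comment> \<open>For \<open>x \<ge> 0\<close> the argument of \<open>hyp_integral n\<close> in
    the integrand is \<open>C - ln (b + x)\<close>; it reaches 0 at \<open>R\<close>, beyond which
    the slices have volume 0.\<close>
  define C where "C = ln T - real n * ln b"
  define R where "R = T / b ^ n - b"
  define f where "f = (\<lambda>x. (2 * b) ^ n * hyp_integral n (C - ln (b + x)))"
  \<comment> \<open>An antiderivative of \<open>f\<close>, found by the substitution
    \<open>u = C - ln (b + x)\<close> and integration by parts, using
    \<open>(b + x) * exp u = exp C\<close>.\<close>
  define F where "F = (\<lambda>x. (2 * b) ^ n * ((b + x) * hyp_integral n (C - ln (b + x)) - exp C * (C - ln (b + x)) ^ n / fact n))"
  have eC: "exp C = T / b ^ n"
  proof -
    have "exp C = exp (ln T - ln (b ^ n))" using b by (simp add: C_def ln_realpow)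
    then show ?thesis using T bn by (simp add: exp_diff)
  qed
  have R: "0 \<le> R" using True bn b by (simp add: R_def field_simps)
  have lnR: "C = ln (b + R)" 
    unfolding R_def using eC by (metis add.commute diff_add_cancel ln_exp)
  have "continuous_on UNIV (hyp_integral n)"
    by (intro continuous_at_imp_continuous_on ballI DERIV_isCont[OF DERIV_hyp_integral])
  then have [measurable]: "hyp_integral n \<in> borel_measurable borel"
    by (rule borel_measurable_continuous_onI)
  have fmeas: "f \<in> borel_measurable borel" unfolding f_def by measurable
  have deriv: "(F has_real_derivative f x) (at x)" if x: "0 \<le> x" for x
  proof -
    define u where "u = C - ln (b + x)"
    have bx: "0 < b + x" using b x by simp
    define D where "D = (if n = 0 then 0 else exp u * u ^ (n - 1) / fact (n - 1))"
    have eu: "exp C = (b + x) * exp u" using bx by (simp add: u_def exp_diff)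
    have l: "((\<lambda>x. C - ln (b + x)) has_real_derivative - 1 / (b + x)) (at x)"
      using bx by (auto intro!: derivative_eq_intros)
    have 1: "((\<lambda>x. hyp_integral n (C - ln (b + x))) has_real_derivative D * (- 1 / (b + x))) (at x)"
      unfolding D_def u_def by (rule DERIV_chain2[OF DERIV_hyp_integral l])
    have 2: "((\<lambda>x. (C - ln (b + x)) ^ n) has_real_derivative real n * u ^ (n - 1) * (- 1 / (b + x))) (at x)"
      unfolding u_def using DERIV_power[OF l, of n] by (simp add: mult_ac)
    have "(F has_real_derivative (2 * b) ^ n * (1 * hyp_integral n u + (D * (- 1 / (b + x))) * (b + x)
        - exp C * (real n * u ^ (n - 1) * (- 1 / (b + x))) / fact n)) (at x)"
      unfolding F_def u_def
      by (intro DERIV_cmult DERIV_diff DERIV_mult DERIV_cdivide 1[unfolded u_def] 2[unfolded u_def])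
        (auto intro!: derivative_eq_intros)
    moreover have "exp C * (real n * u ^ (n - 1) * (- 1 / (b + x))) / fact n = - D"
    proof (cases n)
      case (Suc m)
      have "real n / fact n = 1 / fact m"
        unfolding Suc fact_Suc using of_nat_neq_0[of m] by (simp del: of_nat_Suc)
      moreover have "exp C * (real n * u ^ (n - 1) * (- 1 / (b + x))) / fact n =
          - (exp C / (b + x) * u ^ m * (real n / fact n))"
        by (simp add: Suc)
      moreover have "exp C / (b + x) = exp u" using eu bx by simp
      ultimately show ?thesis
        by (simp add: D_def Suc)
    qed (simp add: D_def)
    ultimately show ?thesis
      using bx by (simp add: f_def u_def)
  qed
  have nonneg: "0 \<le> f x" if "0 \<le> x" "x \<le> R" for x
  proof -
    have "ln (b + x) \<le> C" unfolding lnR using that b by (subst ln_le_cancel_iff) auto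
    then show ?thesis using b by (simp add: f_def hyp_integral_nonneg)
  qed
  have "(\<integral>\<^sup>+x. ennreal (hyp_volume b n (T / (b + \<bar>x\<bar>))) \<partial>lborel) =
      2 * (\<integral>\<^sup>+x. ennreal (hyp_volume b n (T / (b + x))) * indicator {0..} x \<partial>lborel)"
    by (rule nn_integral_even) measurable
  also have "(\<integral>\<^sup>+x. ennreal (hyp_volume b n (T / (b + x))) * indicator {0..} x \<partial>lborel) =
      (\<integral>\<^sup>+x. ennreal (f x) * indicator {0..R} x \<partial>lborel)"
  proof (rule nn_integral_cong_AE)
    \<comment> \<open>At \<open>x = R\<close> the strict inequality in \<open>hyp_volume\<close>
      fails while \<open>R\<close> still lies in \<open>{0..R}\<close>. For \<open>n = 0\<close> the
      two sides differ there, so equality holds only almost everywhere.\<close>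
    have eq: "ennreal (hyp_volume b n (T / (b + x))) * indicator {0..} x = ennreal (f x) * indicator {0..R} x"
      if "x \<noteq> R" for x
    proof (cases "0 \<le> x")
      case True
      have "b ^ n < T / (b + x) \<longleftrightarrow> b ^ n * (b + x) < T"
        using True b by (subst pos_less_divide_eq) auto
      also have "\<dots> \<longleftrightarrow> b + x < T / b ^ n"
        using bn by (subst pos_less_divide_eq) (auto simp: mult.commute)
      finally have "b ^ n < T / (b + x) \<longleftrightarrow> x < R"
        by (auto simp: R_def)
      moreover have "ln (T / (b + x)) = ln T - ln (b + x)"
        using True b T by (subst ln_div) auto
      then have "C - ln (b + x) = ln (T / (b + x)) - real n * ln b"
        by (simp add: C_def)
      ultimately show ?thesis
        using True that by (auto simp: hyp_volume_def f_def indicator_def)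
    qed simp
    show "AE x in lborel. ennreal (hyp_volume b n (T / (b + x))) * indicator {0..} x =
        ennreal (f x) * indicator {0..R} x"
      by (rule AE_mp[OF AE_lborel_singleton[of R] AE_I2]) (intro impI eq)
  qed
  also have "\<dots> = ennreal (F R - F 0)"
    by (rule nn_integral_FTC_Icc[OF fmeas _ _ R]) (use deriv nonneg in auto)
  \<comment> \<open>At \<open>R\<close> the argument is 0 and the two terms of \<open>F\<close>
    cancel; at 0 the recursion of \<open>hyp_integral\<close> turns \<open>F 0\<close> into a
    negative multiple of \<open>hyp_integral (Suc n)\<close>.\<close>
  also have "F R - F 0 = (2 * b) ^ n * b * hyp_integral (Suc n) (ln T - real (Suc n) * ln b)"
  proof -
    have c: "C - ln b = ln T - real (Suc n) * ln b" by (simp add: C_def algebra_simps)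
    have e: "exp C = b * exp (C - ln b)" using b by (simp add: exp_diff)
    have "b + R = exp C" using eC by (simp add: R_def)
    then have "F R = 0"
      using lnR by (cases "n = 0") (simp_all add: F_def hyp_integral_zero)
    moreover have "F 0 = (2 * b) ^ n * (b * hyp_integral n (C - ln b) - b * exp (C - ln b) * (C - ln b) ^ n / fact n)"
      unfolding F_def e by simp
    ultimately show ?thesis unfolding c[symmetric] by (simp add: algebra_simps)
  qed
  also have "2 * ennreal \<dots> = ennreal (2 * ((2 * b) ^ n * b * hyp_integral (Suc n) (ln T - real (Suc n) * ln b)))"
    by (subst ennreal_mult') auto
  finally show ?thesis
    using True unfolding hyp_volume_def by (simp add: mult_ac del: hyp_integral.simps)
qed

subsection \<open>Counting lattice points\<close>

lemma measurable_round: "(round :: real \<Rightarrow> int) \<in> lborel \<rightarrow>\<^sub>M count_space UNIV"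
  unfolding round_def by measurable

text \<open>The fibre over \<open>m\<close> is a half-open unit interval around it, so
  \<open>round\<close> carries Lebesgue measure to counting measure and sums over the integers
  become integrals exactly.\<close>

lemma distr_lborel_round: "distr lborel (count_space UNIV) (round :: real \<Rightarrow> int) = count_space (UNIV :: int set)"
proof (rule measure_eqI_countable[where A = UNIV])
  fix m :: int
  have "(round :: real \<Rightarrow> int) -` {m} = {real_of_int m - 1/2..<real_of_int m + 1/2}"
    by (auto simp: round_def) linarith+
  then show "emeasure (distr lborel (count_space UNIV) (round :: real \<Rightarrow> int)) {m} = emeasure (count_space UNIV) {m}"
    by (simp add: emeasure_distr[OF measurable_round])
qed auto

lemma nn_integral_count_space_int:
  fixes f :: "int \<Rightarrow> ennreal"
  shows "(\<integral>\<^sup>+m. f m \<partial>count_space UNIV) = (\<integral>\<^sup>+x. f (round (x :: real)) \<partial>lborel)"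
  by (subst distr_lborel_round[symmetric]) (simp add: nn_integral_distr[OF measurable_round])

text \<open>The index set is a parameter and the points are extensional functions on it, so that
  coordinates can be added one at a time by induction; the type \<open>int ^ 's\<close> has a fixed
  dimension.\<close>

definition hyp_cross :: "real \<Rightarrow> 'i set \<Rightarrow> real \<Rightarrow> ('i \<Rightarrow> int) set" where
  "hyp_cross a I T = {k \<in> I \<rightarrow>\<^sub>E UNIV. (\<Prod>i\<in>I. a + \<bar>of_int (k i)\<bar>) < T}"

text \<open>The discrete analogue of slicing: splitting off the coordinate \<open>i\<close> gives a
  bijection with pairs \<open>(m, k)\<close>, which are counted by Tonelli. Values in
  \<open>ennreal\<close> admit infinite sets, so finiteness can be deduced afterwards from the
  volume bound.\<close>

lemma emeasure_hyp_cross_insert: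
  assumes "finite I" "i \<notin> I" "0 < a"
  shows "emeasure (count_space UNIV) (hyp_cross a (insert i I) T) =
    (\<integral>\<^sup>+m. emeasure (count_space UNIV) (hyp_cross a I (T / (a + \<bar>of_int m\<bar>))) \<partial>count_space UNIV)"
proof -
  define g where "g = (\<lambda>(m, k). k(i := m) :: 'a \<Rightarrow> int)"
  define P where "P = {(m, k). k \<in> hyp_cross a I (T / (a + \<bar>of_int m\<bar>))}"
  have inj: "inj_on g P"
  proof (rule inj_onI, clarsimp simp: g_def P_def)
    fix m k m' k'
    assume k: "k \<in> hyp_cross a I (T / (a + \<bar>of_int m\<bar>))" "k' \<in> hyp_cross a I (T / (a + \<bar>of_int m'\<bar>))"
      and eq: "k(i := m) = k'(i := m')"
    have "k j = k' j" for j
    proof (cases "j = i")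
      case True
      then show ?thesis using k assms by (auto simp: hyp_cross_def PiE_def extensional_def)
    next
      case False
      then show ?thesis using fun_cong[OF eq, of j] by simp
    qed
    then show "m = m' \<and> k = k'" using fun_cong[OF eq, of i] by auto
  qed
  have prod: "(\<Prod>j\<in>insert i I. a + \<bar>of_int ((k(i := m)) j)\<bar>) = (a + \<bar>of_int m\<bar>) * (\<Prod>j\<in>I. a + \<bar>of_int (k j)\<bar> :: real)"
    for k m
  proof -
    have "(\<Prod>j\<in>I. a + \<bar>of_int ((k(i := m)) j)\<bar> :: real) = (\<Prod>j\<in>I. a + \<bar>of_int (k j)\<bar>)"
      using assms by (intro prod.cong) auto
    then show ?thesis using assms by simp
  qed
  have iff: "(\<Prod>j\<in>I. a + \<bar>of_int (k j)\<bar>) < T / (a + \<bar>of_int m\<bar>) \<longleftrightarrow>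
      (\<Prod>j\<in>insert i I. a + \<bar>of_int ((k(i := m)) j)\<bar>) < T" for k m
    unfolding prod using assms by (subst pos_less_divide_eq) (auto simp: mult.commute)
  have img: "g ` P = hyp_cross a (insert i I) T"
  proof (intro equalityI subsetI)
    fix k assume "k \<in> g ` P"
    then obtain m k' where k: "k = k'(i := m)" "k' \<in> hyp_cross a I (T / (a + \<bar>of_int m\<bar>))"
      by (auto simp: g_def P_def)
    then show "k \<in> hyp_cross a (insert i I) T"
      using iff[of k' m] unfolding hyp_cross_def
      by (auto simp: PiE_def extensional_def simp del: fun_upd_apply)
        (auto)
  next
    fix k assume k: "k \<in> hyp_cross a (insert i I) T"
    \<comment> \<open>Resetting the coordinate \<open>i\<close> to \<open>undefined\<close> makes
      the function extensional on \<open>I\<close>.\<close>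
    have "k = g (k i, k(i := undefined))" by (simp add: g_def)
    moreover have "(k i, k(i := undefined)) \<in> P"
      using k iff[of "k(i := undefined)" "k i"] unfolding hyp_cross_def P_def
      by (auto simp: PiE_def extensional_def)
    ultimately show "k \<in> g ` P" by blast
  qed
  have "emeasure (count_space UNIV) (hyp_cross a (insert i I) T) = (\<integral>\<^sup>+p. indicator P p \<partial>count_space UNIV)"
    using bij_betw_imageI[OF inj img]
    by (simp add: emeasure_count_space bij_betw_finite bij_betw_same_card)
  also have "\<dots> = (\<integral>\<^sup>+m. \<integral>\<^sup>+k. indicator P (m, k) \<partial>count_space UNIV \<partial>count_space UNIV)"
    by (rule nn_integral_fst_count_space[symmetric])
  also have "\<dots> = (\<integral>\<^sup>+m. \<integral>\<^sup>+k. indicator (hyp_cross a I (T / (a + \<bar>of_int m\<bar>))) k \<partial>count_space UNIV \<partial>count_space UNIV)"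
    by (intro nn_integral_cong) (auto simp: P_def indicator_def)
  also have "\<dots> = (\<integral>\<^sup>+m. emeasure (count_space UNIV) (hyp_cross a I (T / (a + \<bar>of_int m\<bar>))) \<partial>count_space UNIV)"
    by simp
  finally show ?thesis .
qed

lemma abs_round_bounds:
  "\<bar>x\<bar> - 1/2 \<le> \<bar>of_int (round x)\<bar>" "\<bar>of_int (round x)\<bar> \<le> \<bar>x\<bar> + 1/2" for x :: real
  using of_int_round_abs_le[of x] by linarith+

text \<open>As \<open>|x| - 1/2 \<le> |round x|\<close>, replacing \<open>a + |round x|\<close> by
  \<open>a - 1/2 + |x|\<close> only enlarges the bound of the slice; integrating over
  \<open>x\<close> then reproduces the recursion for the volume.\<close>

lemma emeasure_hyp_cross_upper:
  assumes "finite I" and a: "1/2 < a"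
  shows "emeasure (count_space UNIV) (hyp_cross a I T) \<le> ennreal (hyp_volume (a - 1/2) (card I) T)"
  using assms(1)
proof (induction I arbitrary: T)
  case empty
  then show ?case by (auto simp: hyp_cross_def hyp_volume_def)
next
  case (insert i I)
  have "emeasure (count_space UNIV) (hyp_cross a (insert i I) T) =
      (\<integral>\<^sup>+x. emeasure (count_space UNIV) (hyp_cross a I (T / (a + \<bar>of_int (round (x :: real))\<bar>))) \<partial>lborel)"
    using insert a by (simp add: emeasure_hyp_cross_insert nn_integral_count_space_int)
  also have "\<dots> \<le> (\<integral>\<^sup>+x. ennreal (hyp_volume (a - 1/2) (card I) (T / (a - 1/2 + \<bar>x\<bar>))) \<partial>lborel)"
  proof (intro nn_integral_mono)
    fix x :: real
    show "emeasure (count_space UNIV) (hyp_cross a I (T / (a + \<bar>of_int (round x)\<bar>))) \<le>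
        ennreal (hyp_volume (a - 1/2) (card I) (T / (a - 1/2 + \<bar>x\<bar>)))"
    \<comment> \<open>Dividing by a smaller number enlarges the quotient only for
      \<open>T > 0\<close>. Otherwise the slice is empty, since the products are nonnegative and the
      inequality is strict.\<close>
    proof (cases "T > 0")
      case True
      then have "T / (a + \<bar>of_int (round x)\<bar>) \<le> T / (a - 1/2 + \<bar>x\<bar>)"
        using a abs_round_bounds(1)[of x] by (intro divide_left_mono mult_pos_pos) auto
      then show ?thesis
        using a by (intro order_trans[OF insert.IH] ennreal_leI hyp_volume_mono) auto
    next
      case False
      have "hyp_cross a I (T / (a + \<bar>of_int (round x)\<bar>)) = {}"
      proof -
        have "T / (a + \<bar>of_int (round x)\<bar>) \<le> 0"
          using False a by (intro divide_nonpos_pos) auto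
        moreover have "0 \<le> (\<Prod>i\<in>I. a + \<bar>of_int (k i)\<bar>)" for k :: "'a \<Rightarrow> int"
          using a by (intro prod_nonneg) auto
        ultimately show ?thesis
          unfolding hyp_cross_def by (auto simp: not_less intro: order_trans)
      qed
      then show ?thesis by simp
    qed
  qed
  also have "\<dots> = ennreal (hyp_volume (a - 1/2) (card (insert i I)) T)"
    using insert a by (simp add: hyp_volume_Suc)
  finally show ?case .
qed

text \<open>The reverse comparison, from \<open>|round x| \<le> |x| + 1/2\<close>. Positivity of
  \<open>T\<close> passes to every slice and so survives the induction.\<close>

lemma emeasure_hyp_cross_lower:
  assumes "finite I" and a: "0 < a" and "0 < T"
  shows "ennreal (hyp_volume (a + 1/2) (card I) T) \<le> emeasure (count_space UNIV) (hyp_cross a I T)"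
  using assms(1,3)
proof (induction I arbitrary: T)
  case empty
  then show ?case by (auto simp: hyp_cross_def hyp_volume_def)
next
  case (insert i I)
  have "ennreal (hyp_volume (a + 1/2) (card (insert i I)) T) =
      (\<integral>\<^sup>+x. ennreal (hyp_volume (a + 1/2) (card I) (T / (a + 1/2 + \<bar>x\<bar>))) \<partial>lborel)"
    using insert a by (simp add: hyp_volume_Suc)
  also have "\<dots> \<le> (\<integral>\<^sup>+x. emeasure (count_space UNIV) (hyp_cross a I (T / (a + \<bar>of_int (round (x :: real))\<bar>))) \<partial>lborel)"
  proof (intro nn_integral_mono order_trans[OF ennreal_leI insert.IH])
    fix x :: real
    show "0 < T / (a + \<bar>of_int (round x)\<bar>)" using insert.prems a by (intro divide_pos_pos) auto
    have "T / (a + 1/2 + \<bar>x\<bar>) \<le> T / (a + \<bar>of_int (round x)\<bar>)"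
      using insert.prems a abs_round_bounds(2)[of x] by (intro divide_left_mono mult_pos_pos) auto
    then show "hyp_volume (a + 1/2) (card I) (T / (a + 1/2 + \<bar>x\<bar>)) \<le>
        hyp_volume (a + 1/2) (card I) (T / (a + \<bar>of_int (round x)\<bar>))"
      using a by (intro hyp_volume_mono) auto
  qed
  also have "\<dots> = emeasure (count_space UNIV) (hyp_cross a (insert i I) T)"
    using insert a by (simp add: emeasure_hyp_cross_insert nn_integral_count_space_int)
  finally show ?case .
qed

interpretation L2: vector_space "L2_scale :: complex \<Rightarrow> 's::finite L2 \<Rightarrow> 's L2"
  by (rule vector_space_L2_scale)

subsection \<open>Orthonormality of the exponentials\<close>

text \<open>Fubini on the cube: its indicator is a product over the coordinates, and Lebesgue
  measure on vectors is the image of a product measure.\<close>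

lemma torus_integral_prod:
  fixes f :: "'s::finite \<Rightarrow> real \<Rightarrow> complex"
  assumes cont: "\<And>j. continuous_on UNIV (f j)"
  shows "(\<integral>x. (\<Prod>j\<in>UNIV. f j (x $ j)) \<partial>torus_measure) =
    (\<Prod>j\<in>UNIV. (\<integral>t. indicator {-pi..pi} t *\<^sub>R f j t \<partial>lborel))"
proof -
  have meas [measurable]: "f j \<in> borel_measurable borel" for j
    by (rule borel_measurable_continuous_onI[OF cont])
  define h where "h = (\<lambda>j t. indicator {-pi..pi} t *\<^sub>R f j t)"
  have hm [measurable]: "h j \<in> borel_measurable borel" for j
    unfolding h_def by measurable
  have hint: "integrable lborel (h j)" for j
    unfolding h_def
    using borel_integrable_compact[of "{-pi..pi}" "f j"] continuous_on_subset[OF cont]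
    by auto
  interpret product_sigma_finite "\<lambda>_ :: real ^ 's. lborel :: real measure"
    by (rule product_sigma_finite.intro) (rule sigma_finite_lborel)
  have inj: "inj_on (\<lambda>j. axis j (1::real)) (UNIV :: 's set)"
    by (auto simp: inj_on_def axis_eq_axis)
  have Basis: "Basis = (\<lambda>j. axis j (1::real)) ` (UNIV :: 's set)"
    by (auto simp: Basis_vec_def)
  have ind: "indicator (cbox (\<chi> j. - pi) (\<chi> j. pi)) x *\<^sub>R (\<Prod>j\<in>UNIV. f j (x $ j)) = (\<Prod>j\<in>UNIV. h j (x $ j))"
    for x :: "real ^ 's"
  proof (cases "x \<in> cbox (\<chi> j. - pi) (\<chi> j. pi)")
    case True
    then show ?thesis by (simp add: h_def mem_box_cart indicator_def)
  next
    case False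
    then obtain j where "x $ j \<notin> {-pi..pi}" by (auto simp: mem_box_cart)
    then have "h j (x $ j) = 0" by (simp add: h_def indicator_def)
    then have "(\<Prod>j\<in>UNIV. h j (x $ j)) = 0" by auto
    then show ?thesis using False by simp
  qed
  have hvm: "(\<lambda>x :: real ^ 's. \<Prod>j\<in>UNIV. h j (x $ j)) \<in> borel_measurable borel"
  proof (rule borel_measurable_prod)
    fix j :: 's
    have "(\<lambda>x :: real ^ 's. x $ j) \<in> borel_measurable borel"
      by (intro borel_measurable_continuous_onI continuous_intros)
    then show "(\<lambda>x :: real ^ 's. h j (x $ j)) \<in> borel_measurable borel"
      by (rule measurable_compose[OF _ hm])
  qed
  have "(\<integral>x. (\<Prod>j\<in>UNIV. f j (x $ j)) \<partial>torus_measure) =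
      (\<integral>x. indicator (cbox (\<chi> j. - pi) (\<chi> j. pi)) x *\<^sub>R (\<Prod>j\<in>UNIV. f j (x $ j)) \<partial>lebesgue)"
    unfolding torus_measure_def by (rule integral_restrict_space) simp
  also have "\<dots> = (\<integral>x. (\<Prod>j\<in>UNIV. h j (x $ j)) \<partial>lborel)"
    unfolding ind by (rule integral_completion) (use hvm in simp)
  also have "\<dots> = (\<integral>y. (\<Prod>j\<in>UNIV. h j ((\<Sum>b\<in>Basis. y b *\<^sub>R (b :: real ^ 's)) $ j)) \<partial>(\<Pi>\<^sub>M b\<in>Basis. lborel))"
    by (subst lborel_eq, rule integral_distr) (auto intro: hvm)
  \<comment> \<open>The product measure is indexed by basis vectors; \<open>axis_index\<close> turns
    them back into coordinates.\<close>
  also have "\<dots> = (\<integral>y. (\<Prod>b\<in>Basis. h (axis_index b) (y (b :: real ^ 's))) \<partial>(\<Pi>\<^sub>M b\<in>Basis. lborel))"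
  proof (rule Bochner_Integration.integral_cong[OF refl])
    fix y :: "real ^ 's \<Rightarrow> real"
    have comp: "(\<Sum>b\<in>Basis. y b *\<^sub>R (b :: real ^ 's)) $ j = y (axis j 1)" for j
      by (subst Basis, subst sum.reindex[OF inj]) (simp add: axis_def if_distrib cong: if_cong)
    show "(\<Prod>j\<in>UNIV. h j ((\<Sum>b\<in>Basis. y b *\<^sub>R (b :: real ^ 's)) $ j)) =
        (\<Prod>b\<in>Basis. h (axis_index b) (y b))"
      unfolding comp by (subst Basis, subst prod.reindex[OF inj]) (simp add: axis_index_axis)
  qed
  also have "\<dots> = (\<Prod>b\<in>(Basis :: (real ^ 's) set). integral\<^sup>L lborel (h (axis_index b)))"
    by (rule product_integral_prod) (auto intro: hint)
  also have "\<dots> = (\<Prod>j\<in>UNIV. integral\<^sup>L lborel (h j))"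
    by (subst Basis, subst prod.reindex[OF inj]) (simp add: axis_index_axis)
  finally show ?thesis by (simp add: h_def)
qed

text \<open>For nonzero \<open>m\<close> the antiderivative takes the same value at both ends of the
  period.\<close>

lemma integral_cis:
  "(\<integral>t. indicator {-pi..pi} t *\<^sub>R cis (of_int m * t) \<partial>lborel) = (if m = 0 then 2 * complex_of_real pi else 0)"
proof (cases "m = 0")
  case True
  then show ?thesis by (simp add: scaleR_conv_of_real[of "2 * pi"])
next
  case False
  define F where "F = (\<lambda>t. cis (of_int m * t) / (\<i> * of_int m))"
  have "(\<integral>t. indicator {-pi..pi} t *\<^sub>R cis (of_int m * t) \<partial>lborel) = F pi - F (-pi)"
  proof (rule integral_FTC_Icc)
    fix t :: real
    have "((\<lambda>t. cis (of_int m * t)) has_vector_derivative of_int m * (\<i> * cis (of_int m * t))) (at t within {-pi..pi})"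
      unfolding has_vector_derivative_def
      by (auto intro!: derivative_eq_intros simp: scaleR_conv_of_real algebra_simps)
    from has_vector_derivative_divide[OF this, of "\<i> * of_int m"]
    show "(F has_vector_derivative cis (of_int m * t)) (at t within {-pi..pi})"
      using False by (simp add: F_def)
  qed (auto intro!: continuous_intros)
  also have "cis (of_int m * pi) = cis (- (of_int m * pi))"
  proof -
    have "sin (of_int m * pi) = 0" by (simp add: sin_zero_iff_int2) 
    then show ?thesis by (simp add: complex_eq_iff)
  qed
  then have "F pi - F (- pi) = 0" by (simp add: F_def)
  finally show ?thesis using False by simp
qed

lemma square_integrable_iff_L2_rel: "L2_rel f f \<longleftrightarrow> square_integrable f"
  by (simp add: L2_rel_def)

lemma cis_sum: "finite A \<Longrightarrow> cis (\<Sum>j\<in>A. f j) = (\<Prod>j\<in>A. cis (f j))"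
  by (induction A rule: finite_induct) (simp_all add: cis_mult[symmetric])

text \<open>The integrand is the exponential of frequency \<open>k - l\<close>, which factors over
  the coordinates; a coordinate in which \<open>k\<close> and \<open>l\<close> differ contributes a
  zero factor.\<close>

lemma L2_cinner_exp: "L2_cinner (L2_exp k) (L2_exp l :: 's::finite L2) = (if k = l then 1 else 0)"
proof -
  have "L2_cinner (L2_exp k) (L2_exp l :: 's L2) =
      (\<integral>x. (\<Prod>j\<in>UNIV. cis (of_int (k $ j - l $ j) * x $ j)) \<partial>torus_measure) / (2 * complex_of_real pi) ^ CARD('s)"
  proof (transfer fixing: k l)
    have "cis (\<Sum>j\<in>UNIV. of_int (k $ j) * x $ j) * cnj (cis (\<Sum>j\<in>UNIV. of_int (l $ j) * x $ j)) =
        (\<Prod>j\<in>UNIV. cis (of_int (k $ j - l $ j) * x $ j))" for x :: "real ^ 's"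
      by (simp add: cis_cnj cis_mult cis_sum[symmetric] sum_subtractf algebra_simps)
    then show "(\<integral>x. cis (\<Sum>j\<in>UNIV. of_int (k $ j) * x $ j) * cnj (cis (\<Sum>j\<in>UNIV. of_int (l $ j) * x $ j)) \<partial>torus_measure) /
        (2 * complex_of_real pi) ^ CARD('s) =
      (\<integral>x. (\<Prod>j\<in>UNIV. cis (of_int (k $ j - l $ j) * (x :: real ^ 's) $ j)) \<partial>torus_measure) / (2 * complex_of_real pi) ^ CARD('s)"
      by simp
  qed
  also have "(\<integral>x. (\<Prod>j\<in>UNIV. cis (of_int (k $ j - l $ j) * x $ j)) \<partial>torus_measure) =
      (\<Prod>j\<in>UNIV. if k $ j - l $ j = 0 then 2 * complex_of_real pi else 0)"
    by (subst torus_integral_prod) (auto intro!: continuous_intros simp only: integral_cis)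
  also have "\<dots> / (2 * complex_of_real pi) ^ CARD('s) = (if k = l then 1 else 0)"
  proof (cases "k = l")
    case False
    then obtain j where "k $ j \<noteq> l $ j" by (auto simp: vec_eq_iff)
    then show ?thesis using False by auto
  qed simp
  finally show ?thesis .
qed

subsection \<open>Orthogonal expansions\<close>

lemma L2_cinner_add_right: "L2_cinner f (g + h) = L2_cinner f g + L2_cinner f h"
  by (metis L2_cinner_add_left L2_cinner_cnj complex_cnj_add)

lemma L2_cinner_scale_right: "L2_cinner f (L2_scale c g) = cnj c * L2_cinner f g"
  by (metis L2_cinner_scale_left L2_cinner_cnj complex_cnj_mult)

lemma L2_cinner_zero [simp]: "L2_cinner 0 f = 0" "L2_cinner f 0 = 0"
  using L2_cinner_add_left[of 0 0 f] L2_cinner_add_right[of f 0 0] by simp_all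

lemma L2_cinner_minus_left: "L2_cinner (- f) g = - L2_cinner f g"
  using L2_cinner_add_left[of f "- f" g] by (simp add: eq_neg_iff_add_eq_0 add.commute)

lemma L2_cinner_diff_left: "L2_cinner (f - g) h = L2_cinner f h - L2_cinner g h"
  using L2_cinner_add_left[of f "- g" h] by (simp add: L2_cinner_minus_left)

lemma L2_cinner_sum_left: "L2_cinner (\<Sum>k\<in>A. f k) g = (\<Sum>k\<in>A. L2_cinner (f k) g)"
  by (induction A rule: infinite_finite_induct) (simp_all add: L2_cinner_add_left)

lemma L2_cinner_self_norm: "L2_cinner f f = complex_of_real ((norm f)\<^sup>2)"
proof -
  obtain v where v: "v \<ge> 0" "L2_cinner f f = complex_of_real v" using L2_cinner_self[of f] by blast
  then show ?thesis by (simp add: norm_L2_def)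
qed

lemma norm_L2_scale: "norm (L2_scale c f) = cmod c * norm f"
proof -
  have "complex_of_real ((norm (L2_scale c f))\<^sup>2) = c * cnj c * complex_of_real ((norm f)\<^sup>2)"
    by (simp only: L2_cinner_self_norm[symmetric] L2_cinner_scale_left L2_cinner_scale_right mult_ac)
  also have "\<dots> = complex_of_real ((cmod c * norm f)\<^sup>2)"
    by (simp add: complex_norm_square[symmetric] power_mult_distrib)
  finally have "(norm (L2_scale c f))\<^sup>2 = (cmod c * norm f)\<^sup>2"
    by (simp only: of_real_eq_iff)
  then show ?thesis by (simp add: power2_eq_iff_nonneg)
qed

lemma norm_add_orthogonal:
  assumes "L2_cinner f g = 0"
  shows "(norm (f + g))\<^sup>2 = (norm f)\<^sup>2 + (norm g)\<^sup>2"
proof -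
  have "L2_cinner g f = 0" using assms L2_cinner_cnj[of g f] by simp
  then have "complex_of_real ((norm (f + g))\<^sup>2) = complex_of_real ((norm f)\<^sup>2 + (norm g)\<^sup>2)"
    using assms by (simp only: L2_cinner_self_norm[symmetric] L2_cinner_add_left L2_cinner_add_right of_real_add)
      simp
  then show ?thesis by (simp only: of_real_eq_iff)
qed

lemma fourier_coeff_simps:
  "fourier_coeff (f + g) k = fourier_coeff f k + fourier_coeff g k"
  "fourier_coeff (f - g) k = fourier_coeff f k - fourier_coeff g k"
  "fourier_coeff (L2_scale c f) k = c * fourier_coeff f k"
  "fourier_coeff (L2_exp l) k = (if k = l then 1 else 0)"
  by (auto simp: fourier_coeff_def L2_cinner_add_left L2_cinner_diff_left L2_cinner_scale_left L2_cinner_exp)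

definition trig_sum :: "(int ^ 's::finite) set \<Rightarrow> (int ^ 's \<Rightarrow> complex) \<Rightarrow> 's L2" where
  "trig_sum S c = (\<Sum>k\<in>S. L2_scale (c k) (L2_exp k))"

lemma trig_sum_in_span: "trig_sum S c \<in> L2.span (L2_exp ` S)"
  unfolding trig_sum_def by (intro L2.span_sum L2.span_scale L2.span_base) auto

lemma fourier_coeff_trig_sum:
  assumes "finite S"
  shows "fourier_coeff (trig_sum S c) k = (if k \<in> S then c k else 0)"
proof -
  have "fourier_coeff (trig_sum S c) k = (\<Sum>l\<in>S. c l * (if l = k then 1 else 0))"
    unfolding fourier_coeff_def trig_sum_def
    by (simp only: L2_cinner_sum_left L2_cinner_scale_left L2_cinner_exp)
  also have "\<dots> = (\<Sum>l\<in>S. if l = k then c l else 0)"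
    by (intro sum.cong) auto
  finally show ?thesis using assms by simp
qed

lemma norm_trig_sum:
  assumes "finite S"
  shows "(norm (trig_sum S c))\<^sup>2 = (\<Sum>k\<in>S. (cmod (c k))\<^sup>2)"
proof -
  have "complex_of_real ((norm (trig_sum S c))\<^sup>2) = (\<Sum>k\<in>S. c k * cnj (fourier_coeff (trig_sum S c) k))"
    by (subst L2_cinner_self_norm[symmetric], subst (1) trig_sum_def)
      (simp only: L2_cinner_sum_left L2_cinner_scale_left fourier_coeff_def L2_cinner_cnj[symmetric])
  also have "\<dots> = complex_of_real (\<Sum>k\<in>S. (cmod (c k))\<^sup>2)"
    using assms by (simp add: fourier_coeff_trig_sum complex_norm_square[symmetric])
  finally show ?thesis by (simp only: of_real_eq_iff)
qed

text \<open>The remainder has vanishing coefficients at the frequencies in \<open>S\<close>, hence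
  is orthogonal to the partial Fourier sum; the rest is Pythagoras.\<close>

lemma norm_eq_residual:
  fixes f :: "'s::finite L2"
  assumes "finite S"
  shows "(norm f)\<^sup>2 = (norm (f - trig_sum S (fourier_coeff f)))\<^sup>2 + (\<Sum>k\<in>S. (cmod (fourier_coeff f k))\<^sup>2)"
proof -
  let ?p = "trig_sum S (fourier_coeff f)"
  have "L2_cinner ?p (f - ?p) = (\<Sum>k\<in>S. fourier_coeff f k * cnj (fourier_coeff (f - ?p) k))"
    by (subst (1) trig_sum_def)
      (simp only: L2_cinner_sum_left L2_cinner_scale_left fourier_coeff_def L2_cinner_cnj[symmetric])
  also have "\<dots> = 0"
    using assms by (simp add: fourier_coeff_simps fourier_coeff_trig_sum)
  finally have "(norm (?p + (f - ?p)))\<^sup>2 = (norm ?p)\<^sup>2 + (norm (f - ?p))\<^sup>2"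
    by (rule norm_add_orthogonal)
  then show ?thesis using norm_trig_sum[OF assms, of "fourier_coeff f"] by simp
qed

lemma Bessel:
  assumes "finite S"
  shows "(\<Sum>k\<in>S. (cmod (fourier_coeff f k))\<^sup>2) \<le> (norm f)\<^sup>2"
  using norm_eq_residual[OF assms, of f] by simp

subsection \<open>Completeness of the trigonometric system\<close>

lemma L2_cases:
  obtains f where "square_integrable f" "F = abs_L2 f"
proof
  show "square_integrable (rep_L2 F)"
    using Quotient3_rep_reflp[OF Quotient3_L2, of F] by (simp add: L2_rel_def)
  show "F = abs_L2 (rep_L2 F)"
    by (simp add: Quotient3_abs_rep[OF Quotient3_L2])
qed

lemma abs_L2_arith:
  assumes "square_integrable f" "square_integrable g"
  shows "abs_L2 f + abs_L2 g = abs_L2 (\<lambda>x. f x + g x)"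
    and "abs_L2 f - abs_L2 g = abs_L2 (\<lambda>x. f x - g x)"
    and "L2_scale c (abs_L2 f) = abs_L2 (\<lambda>x. c * f x)"
  using assms
  by (simp_all add: plus_L2.abs_eq minus_L2.abs_eq L2_scale.abs_eq square_integrable_iff_L2_rel)

lemma abs_L2_cong:
  assumes "square_integrable f" "\<And>x. x \<in> cbox (\<chi> j. - pi) (\<chi> j. pi) \<Longrightarrow> f x = g x"
  shows "square_integrable g" "abs_L2 f = abs_L2 g"
proof -
  have sp: "x \<in> space torus_measure \<longleftrightarrow> x \<in> cbox (\<chi> j. - pi) (\<chi> j. pi)" for x
    by (simp add: torus_measure_def)
  have "f \<in> borel_measurable torus_measure \<longleftrightarrow> g \<in> borel_measurable torus_measure"
    by (rule measurable_cong) (simp add: sp assms(2))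
  moreover have "integrable torus_measure (\<lambda>x. (cmod (f x))\<^sup>2) \<longleftrightarrow> integrable torus_measure (\<lambda>x. (cmod (g x))\<^sup>2)"
    by (rule Bochner_Integration.integrable_cong) (simp_all add: sp assms(2))
  ultimately show g: "square_integrable g" using assms(1) by (simp add: square_integrable_def)
  have "L2_rel f g"
    using assms(1) g by (auto simp: L2_rel_def sp assms(2) intro!: AE_I2)
  then show "abs_L2 f = abs_L2 g"
    by (rule Quotient3_rel_abs[OF Quotient3_L2])
qed

lemma norm_abs_L2_diff:
  fixes f g :: "real ^ 's::finite \<Rightarrow> complex"
  assumes "square_integrable f" "square_integrable g"
  shows "(norm (abs_L2 f - abs_L2 g))\<^sup>2 = (\<integral>x. (cmod (f x - g x))\<^sup>2 \<partial>torus_measure) / (2 * pi) ^ CARD('s)"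
proof -
  let ?h = "\<lambda>x. f x - g x"
  have h: "square_integrable ?h" using assms by (rule square_integrable_diff)
  have "complex_of_real ((norm (abs_L2 ?h))\<^sup>2) =
      (\<integral>x. ?h x * cnj (?h x) \<partial>torus_measure) / (2 * complex_of_real pi) ^ CARD('s)"
    unfolding L2_cinner_self_norm[symmetric]
    using h by (simp add: L2_cinner.abs_eq square_integrable_iff_L2_rel)
  also have "\<dots> = complex_of_real ((\<integral>x. (cmod (?h x))\<^sup>2 \<partial>torus_measure) / (2 * pi) ^ CARD('s))"
    by (simp only: complex_norm_square[symmetric] integral_complex_of_real[symmetric] of_real_divide
        of_real_power of_real_mult of_real_numeral)
  finally show ?thesis
    using assms by (simp only: of_real_eq_iff abs_L2_arith)
qed

abbreviation trig_closure :: "'s::finite L2 set" where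
  "trig_closure \<equiv> closure (L2.span (range L2_exp))"

lemma trig_closure_add:
  assumes "f \<in> trig_closure" "g \<in> trig_closure"
  shows "f + g \<in> trig_closure"
  unfolding closure_approachable
proof (intro allI impI)
  fix e :: real assume "e > 0"
  then obtain p q where "p \<in> L2.span (range L2_exp)" "dist p f < e / 2"
    "q \<in> L2.span (range L2_exp)" "dist q g < e / 2"
    using assms unfolding closure_approachable by (meson half_gt_zero)
  then show "\<exists>y\<in>L2.span (range L2_exp). dist y (f + g) < e"
    by (intro bexI[of _ "p + q"] L2.span_add dist_triangle_add_half)
qed

lemma trig_closure_scale:
  assumes "f \<in> trig_closure"
  shows "L2_scale c f \<in> trig_closure"
  unfolding closure_approachable
proof (intro allI impI)
  fix e :: real assume e: "e > 0"
  have c: "0 < cmod c + 1" by (simp add: add_nonneg_pos)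
  with e obtain p where p: "p \<in> L2.span (range L2_exp)" "dist p f < e / (cmod c + 1)"
    using assms unfolding closure_approachable by (meson divide_pos_pos)
  have "dist (L2_scale c p) (L2_scale c f) = cmod c * dist p f"
    by (simp add: dist_norm L2.scale_right_diff_distrib[symmetric] norm_L2_scale)
  also have "\<dots> \<le> (cmod c + 1) * dist p f" by (intro mult_right_mono) auto
  also have "\<dots> < e" using p(2) c by (simp add: pos_less_divide_eq mult.commute)
  finally show "\<exists>y\<in>L2.span (range L2_exp). dist y (L2_scale c f) < e"
    using p(1) by (intro bexI[of _ "L2_scale c p"] L2.span_scale)
qed

text \<open>Dominated convergence turns pointwise convergence on the cube into convergence in
  \<open>L2\<close>. This carries density from trigonometric polynomials to continuous functions,
  from these to indicators of compact sets, and from simple functions to the whole space.\<close>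

lemma trig_closure_dominated:
  fixes g :: "nat \<Rightarrow> real ^ 's::finite \<Rightarrow> complex"
  assumes g: "\<And>n. square_integrable (g n)" "\<And>n. abs_L2 (g n) \<in> trig_closure"
    and f: "square_integrable f" and w: "square_integrable w"
    and dom: "\<And>n x. x \<in> cbox (\<chi> j. - pi) (\<chi> j. pi) \<Longrightarrow> cmod (g n x) \<le> cmod (w x)"
    and lim: "\<And>x. x \<in> cbox (\<chi> j. - pi) (\<chi> j. pi) \<Longrightarrow> (\<lambda>n. g n x) \<longlonglongrightarrow> f x"
  shows "abs_L2 f \<in> trig_closure"
proof -
  have sp: "space torus_measure = cbox (\<chi> j. - pi) (\<chi> j. pi :: real ^ 's)"
    by (simp add: torus_measure_def)
  have [measurable]: "g n \<in> borel_measurable torus_measure" "f \<in> borel_measurable torus_measure" for n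
    using g f by (auto simp: square_integrable_def)
  have "(\<lambda>n. \<integral>x. (cmod (g n x - f x))\<^sup>2 \<partial>torus_measure) \<longlonglongrightarrow> (\<integral>x. (0 :: real) \<partial>(torus_measure :: (real ^ 's) measure))"
  \<comment> \<open>The limit inherits the bound by \<open>w\<close>, so the difference has modulus
    at most \<open>2 * cmod (w x)\<close>; squaring gives the factor 4.\<close>
  proof (rule integral_dominated_convergence[where w = "\<lambda>x. 4 * (cmod (w x))\<^sup>2"])
    show "integrable torus_measure (\<lambda>x. 4 * (cmod (w x))\<^sup>2)"
      using w by (simp add: square_integrable_def)
    show "AE x in torus_measure. (\<lambda>n. (cmod (g n x - f x))\<^sup>2) \<longlonglongrightarrow> 0"
    proof (rule AE_I2)
      fix x :: "real ^ 's" assume "x \<in> space torus_measure"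
      then have "(\<lambda>n. g n x - f x) \<longlonglongrightarrow> 0"
        using lim[of x] by (simp add: sp LIM_zero)
      then show "(\<lambda>n. (cmod (g n x - f x))\<^sup>2) \<longlonglongrightarrow> 0"
        by (intro tendsto_null_power tendsto_norm_zero) auto
    qed
    show "AE x in torus_measure. norm ((cmod (g n x - f x))\<^sup>2) \<le> 4 * (cmod (w x))\<^sup>2" for n
    proof (rule AE_I2)
      fix x :: "real ^ 's" assume x: "x \<in> space torus_measure"
      have "cmod (f x) \<le> cmod (w x)"
        by (rule LIMSEQ_le_const2[OF tendsto_norm[OF lim]]) (use x dom in \<open>auto simp: sp\<close>)
      then have "cmod (g n x - f x) \<le> 2 * cmod (w x)"
        using norm_triangle_ineq4[of "g n x" "f x"] dom[of x n] x by (simp add: sp)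
      then have "(cmod (g n x - f x))\<^sup>2 \<le> (2 * cmod (w x))\<^sup>2"
        by (intro power_mono) auto
      then show "norm ((cmod (g n x - f x))\<^sup>2) \<le> 4 * (cmod (w x))\<^sup>2"
        by (simp add: power_mult_distrib)
    qed
  qed auto
  then have "(\<lambda>n. (\<integral>x. (cmod (g n x - f x))\<^sup>2 \<partial>torus_measure) / (2 * pi) ^ CARD('s)) \<longlonglongrightarrow> 0 / (2 * pi) ^ CARD('s)"
    by (intro tendsto_divide) auto
  then have "(\<lambda>n. (norm (abs_L2 (g n) - abs_L2 f))\<^sup>2) \<longlonglongrightarrow> 0"
    using g f by (simp add: norm_abs_L2_diff)
  then have "(\<lambda>n. sqrt ((norm (abs_L2 (g n) - abs_L2 f))\<^sup>2)) \<longlonglongrightarrow> sqrt 0"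
    by (rule tendsto_real_sqrt)
  then have "(\<lambda>n. abs_L2 (g n)) \<longlonglongrightarrow> abs_L2 f"
    by (simp add: LIM_zero_iff tendsto_norm_zero_iff)
  then show ?thesis
    by (intro closed_sequentially[OF closed_closure g(2)])
qed

section \<open>Trigonometric polynomials as functions\<close>

inductive trig_poly :: "(real ^ 's::finite \<Rightarrow> complex) \<Rightarrow> bool" where
  exp: "trig_poly (\<lambda>x. c * cis (\<Sum>j\<in>UNIV. of_int (k $ j) * x $ j))"
| add: "trig_poly f \<Longrightarrow> trig_poly g \<Longrightarrow> trig_poly (\<lambda>x. f x + g x)"

lemma trig_poly_span:
  fixes f :: "real ^ 's::finite \<Rightarrow> complex"
  assumes "trig_poly f"
  shows "square_integrable f \<and> abs_L2 f \<in> L2.span (range L2_exp)"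
  using assms
proof induction
  case (exp c k)
  have "L2_scale c (L2_exp k) = abs_L2 (\<lambda>x. c * cis (\<Sum>j\<in>UNIV. of_int (k $ j) * x $ j))"
    by (simp add: L2_exp.abs_eq abs_L2_arith(3)[OF exp_square_integrable exp_square_integrable])
  moreover have "L2_scale c (L2_exp k) \<in> L2.span (range L2_exp)"
    by (intro L2.span_scale L2.span_base) simp
  ultimately show ?case by (simp add: square_integrable_scale exp_square_integrable)
next
  case (add f g)
  then show ?case by (simp add: square_integrable_add L2.span_add flip: abs_L2_arith(1))
qed

lemma trig_poly_cmult: "trig_poly f \<Longrightarrow> trig_poly (\<lambda>x. c * f x)"
proof (induction rule: trig_poly.induct)
  case (exp d k)
  then show ?case using trig_poly.exp[of "c * d" k] by (simp add: mult.assoc)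
next
  case (add f g)
  then show ?case using trig_poly.add by (simp add: distrib_left)
qed

text \<open>Frequencies add under multiplication. Products are formed for functions rather than
  classes, because a product of square integrable functions need not be square integrable.\<close>

lemma trig_poly_mult:
  assumes "trig_poly f" "trig_poly g"
  shows "trig_poly (\<lambda>x. f x * g x)"
  using assms(1)
proof induction
  case (exp c k)
  show ?case
    using assms(2)
  proof induction
    case (exp d l)
    have "(\<lambda>x. c * cis (\<Sum>j\<in>UNIV. of_int (k $ j) * x $ j) * (d * cis (\<Sum>j\<in>UNIV. of_int (l $ j) * x $ j))) =
        (\<lambda>x. c * d * cis (\<Sum>j\<in>UNIV. of_int ((k + l) $ j) * x $ j))"
      by (simp add: fun_eq_iff algebra_simps sum.distrib cis_mult[symmetric])
    then show ?case using trig_poly.exp[of "c * d" "k + l"] by simp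
  next
    case (add f g)
    then show ?case using trig_poly.add by (simp add: distrib_left)
  qed
next
  case (add f g)
  then show ?case using trig_poly.add by (simp add: distrib_right)
qed

lemma trig_poly_const: "trig_poly (\<lambda>x. c)"
  using trig_poly.exp[of c 0] by simp

lemma trig_poly_sum: "(\<And>i. i \<in> A \<Longrightarrow> trig_poly (f i)) \<Longrightarrow> trig_poly (\<lambda>x. \<Sum>i\<in>A. f i x)"
  by (induction A rule: infinite_finite_induct) (auto intro: trig_poly.add trig_poly_const)

lemma trig_poly_cis: "trig_poly (\<lambda>x. cis (of_int m * x $ j))"
proof -
  have "(\<Sum>i\<in>UNIV. of_int (axis j m $ i) * x $ i) = of_int m * x $ j" for x :: "real ^ 'a"
    by (simp add: axis_def if_distrib[of real_of_int] if_distrib[of "\<lambda>u. u * _"] cong: if_cong)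
  then show ?thesis using trig_poly.exp[of 1 "axis j m"] by simp
qed

text \<open>By Euler's formulas. These are the real and imaginary parts of the coordinates of the
  map \<open>torus_embed\<close> below, from which real polynomials on its image are built.\<close>

lemma trig_poly_cos_sin:
  "trig_poly (\<lambda>x. complex_of_real (cos (x $ j)))" "trig_poly (\<lambda>x. complex_of_real (sin (x $ j)))"
proof -
  have c: "complex_of_real (cos t) = 1/2 * cis (of_int 1 * t) + 1/2 * cis (of_int (-1) * t)" for t
    by (simp add: complex_eq_iff)
  have s: "complex_of_real (sin t) = - \<i>/2 * cis (of_int 1 * t) + \<i>/2 * cis (of_int (-1) * t)" for t
    by (simp add: complex_eq_iff)
  show "trig_poly (\<lambda>x. complex_of_real (cos (x $ j)))" "trig_poly (\<lambda>x. complex_of_real (sin (x $ j)))"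
    unfolding c s by (intro trig_poly.add trig_poly_cmult trig_poly_cis)+
qed

text \<open>On the cube itself the trigonometric polynomials do not separate opposite faces, so the
  Stone-Weierstrass theorem is applied to the image of the cube under this map.\<close>

definition torus_embed :: "real ^ 's::finite \<Rightarrow> complex ^ 's" where
  "torus_embed x = (\<chi> j. cis (x $ j))"

lemma continuous_on_torus_embed: "continuous_on S torus_embed"
  unfolding torus_embed_def by (intro continuous_intros)

text \<open>\<open>Arg\<close> inverts \<open>cis\<close> on angles above \<open>-pi\<close> and up
  to \<open>pi\<close>, so only a coordinate \<open>-pi\<close> of \<open>y\<close> is critical; it
  would force the value \<open>pi\<close> on \<open>x\<close>, which the open cube excludes. The
  asymmetric form suits a compact subset of the open cube compared with arbitrary points of the
  closed one.\<close>

lemma torus_embed_inj: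
  assumes "x \<in> box (\<chi> j. - pi) (\<chi> j. pi)" "y \<in> cbox (\<chi> j. - pi) (\<chi> j. pi)"
    and "torus_embed x = torus_embed y"
  shows "x = y"
proof -
  have "x $ j = y $ j" for j
  proof -
    have eq: "cis (x $ j) = cis (y $ j)" using assms(3) by (simp add: torus_embed_def vec_eq_iff)
    have x: "- pi < x $ j" "x $ j < pi" and y: "- pi \<le> y $ j" "y $ j \<le> pi"
      using assms(1,2) by (auto simp: mem_box_cart)
    have ax: "Arg (cis (x $ j)) = x $ j" using x by (intro Arg_cis) auto
    show ?thesis
    proof (cases "y $ j = - pi")
      case True
      then have "cis (x $ j) = cis pi" using eq by (simp add: complex_eq_iff)
      then show ?thesis using ax x Arg_cis[of pi] by simp
    next
      case False
      then show ?thesis using ax eq y Arg_cis[of "y $ j"] by simp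
    qed
  qed
  then show ?thesis by (simp add: vec_eq_iff)
qed

text \<open>Real polynomials arise from constants and real-linear functionals by sums and products.
  A functional combines real and imaginary parts of coordinates, which on the torus are cosines and
  sines.\<close>

lemma trig_poly_real_polynomial:
  fixes p :: "complex ^ 's::finite \<Rightarrow> real"
  assumes "real_polynomial_function p"
  shows "trig_poly (\<lambda>x. complex_of_real (p (torus_embed x)))"
  using assms
proof induction
  case (linear f)
  interpret f: bounded_linear f by fact
  have fz: "f z = (\<Sum>j\<in>UNIV. Re (z $ j) * f (axis j 1) + Im (z $ j) * f (axis j \<i>))" for z
  proof -
    have "z = (\<Sum>j\<in>UNIV. Re (z $ j) *\<^sub>R axis j 1 + Im (z $ j) *\<^sub>R axis j \<i>)"
      by (simp add: vec_eq_iff axis_def if_distrib[of "scaleR _"] if_distrib[of "\<lambda>u. u + _"] complex_eq_iff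
          sum.distrib cong: if_cong)
    then have "f z = f (\<Sum>j\<in>UNIV. Re (z $ j) *\<^sub>R axis j 1 + Im (z $ j) *\<^sub>R axis j \<i>)"
      by (rule arg_cong)
    then show ?thesis by (simp add: f.sum f.add f.scaleR)
  qed
  have "(\<lambda>x. complex_of_real (f (torus_embed x))) =
      (\<lambda>x. \<Sum>j\<in>UNIV. of_real (f (axis j 1)) * of_real (cos (x $ j)) + of_real (f (axis j \<i>)) * of_real (sin (x $ j)))"
    by (subst fz) (simp add: torus_embed_def mult.commute)
  then show ?case
    by (simp only:) (intro trig_poly_sum trig_poly.add trig_poly_cmult trig_poly_cos_sin)
next
  case (const c)
  show ?case by (rule trig_poly_const)
next
  case (add f g)
  then show ?case using trig_poly.add by simp
next
  case (mult f g)
  then show ?case using trig_poly_mult by simp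
qed

section \<open>Density, from continuous functions to all of the space\<close>

lemma square_integrable_const: "square_integrable (\<lambda>x. c)"
  using trig_poly_span[OF trig_poly_const] by blast

lemma square_integrable_bounded:
  assumes "f \<in> borel_measurable torus_measure" "\<And>x. x \<in> space torus_measure \<Longrightarrow> cmod (f x) \<le> C"
  shows "square_integrable f"
  unfolding square_integrable_def
proof (intro conjI assms(1))
  show "integrable torus_measure (\<lambda>x. (cmod (f x))\<^sup>2)"
  proof (rule Bochner_Integration.integrable_bound)
    show "integrable torus_measure (\<lambda>x. (cmod (complex_of_real C))\<^sup>2)"
      using square_integrable_const[of "complex_of_real C"] unfolding square_integrable_def ..
    show "(\<lambda>x. (cmod (f x))\<^sup>2) \<in> borel_measurable torus_measure"
      using assms(1) by measurable
    show "AE x in torus_measure. norm ((cmod (f x))\<^sup>2) \<le> norm ((cmod (complex_of_real C))\<^sup>2)"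
      using power_mono[OF order_trans[OF assms(2) abs_ge_self] norm_ge_zero, of _ 2] by (intro AE_I2) simp
  qed
qed

text \<open>Stone-Weierstrass on the compact image of the cube gives real polynomials within
  \<open>1 / (n + 1)\<close> of \<open>u\<close>; pulled back to the cube they are trigonometric
  polynomials.\<close>

lemma continuous_in_trig_closure:
  fixes u :: "complex ^ 's::finite \<Rightarrow> real"
  assumes u: "continuous_on UNIV u"
  shows "square_integrable (\<lambda>x. complex_of_real (u (torus_embed x)))"
    and "abs_L2 (\<lambda>x. complex_of_real (u (torus_embed x))) \<in> trig_closure"
proof -
  let ?Q = "cbox (\<chi> j. - pi) (\<chi> j. pi) :: (real ^ 's) set"
  have comp: "compact (torus_embed ` ?Q)"
    by (intro compact_continuous_image continuous_on_torus_embed compact_cbox)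
  then have "bounded (u ` torus_embed ` ?Q)"
    by (intro compact_imp_bounded compact_continuous_image[OF continuous_on_subset[OF u]]) auto
  then obtain B where B: "\<And>x. x \<in> ?Q \<Longrightarrow> \<bar>u (torus_embed x)\<bar> \<le> B"
    unfolding bounded_iff by auto
  have "continuous_on UNIV (\<lambda>x. complex_of_real (u (torus_embed x)))"
    by (intro continuous_on_of_real continuous_on_compose2[OF u] continuous_on_torus_embed) auto
  then have "(\<lambda>x. complex_of_real (u (torus_embed x))) \<in> borel_measurable borel"
    by (rule borel_measurable_continuous_onI)
  then have "(\<lambda>x. complex_of_real (u (torus_embed x))) \<in> borel_measurable torus_measure"
    unfolding torus_measure_def
    by (intro measurable_restrict_space1 measurable_completion) simp
  then show sq: "square_integrable (\<lambda>x. complex_of_real (u (torus_embed x)))"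
    by (rule square_integrable_bounded[where C = B]) (auto simp: torus_measure_def B)
  have "\<exists>p. real_polynomial_function p \<and> (\<forall>z\<in>torus_embed ` ?Q. \<bar>u z - p z\<bar> < 1 / real (Suc n))" for n
    using Stone_Weierstrass_real_polynomial_function[OF comp continuous_on_subset[OF u], of "1 / real (Suc n)"]
    by (metis of_nat_0_less_iff subset_UNIV zero_less_Suc zero_less_divide_1_iff)
  then obtain p where p: "\<And>n. real_polynomial_function (p n)"
    and up: "\<And>n x. x \<in> ?Q \<Longrightarrow> \<bar>u (torus_embed x) - p n (torus_embed x)\<bar> < 1 / real (Suc n)"
    by (metis imageI)
  show "abs_L2 (\<lambda>x. complex_of_real (u (torus_embed x))) \<in> trig_closure"
  \<comment> \<open>\<open>B\<close> bounds \<open>u\<close> on the image and the approximation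
    error is at most 1, whence the dominating constant \<open>B + 1\<close>.\<close>
  proof (rule trig_closure_dominated[OF _ _ sq square_integrable_const[of "complex_of_real (B + 1)"]])
    fix n x assume x: "x \<in> ?Q"
    have "1 / real (Suc n) \<le> 1" by simp
    then show "cmod (complex_of_real (p n (torus_embed x))) \<le> cmod (complex_of_real (B + 1))"
      using up[OF x, of n] B[OF x] unfolding norm_of_real by linarith
  next
    fix x assume x: "x \<in> ?Q"
    have "(\<lambda>n. p n (torus_embed x) - u (torus_embed x)) \<longlonglongrightarrow> 0"
    proof (rule Lim_null_comparison[OF _ LIMSEQ_Suc[OF lim_1_over_n]])
      show "\<forall>\<^sub>F n in sequentially. norm (p n (torus_embed x) - u (torus_embed x)) \<le> 1 / real (Suc n)"
        using less_imp_le[OF up[OF x]] by (simp add: abs_minus_commute)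
    qed
    then show "(\<lambda>n. complex_of_real (p n (torus_embed x))) \<longlonglongrightarrow> complex_of_real (u (torus_embed x))"
      by (intro tendsto_of_real) (simp add: LIM_zero_iff)
  qed (use trig_poly_span[OF trig_poly_real_polynomial[OF p]] closure_subset in blast)+
qed

text \<open>The indicator is a pointwise limit of continuous functions of the distance to the image
  of \<open>K\<close>. As \<open>K\<close> stays in the open cube, no other point of the cube is
  mapped into that image.\<close>

lemma indicator_compact_in_trig_closure:
  fixes K :: "(real ^ 's::finite) set"
  assumes K: "compact K" "K \<subseteq> box (\<chi> j. - pi) (\<chi> j. pi)"
  shows "square_integrable (\<lambda>x. complex_of_real (indicator K x))"
    and "abs_L2 (\<lambda>x. complex_of_real (indicator K x)) \<in> trig_closure"
proof -
  let ?Q = "cbox (\<chi> j. - pi) (\<chi> j. pi) :: (real ^ 's) set"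
  have "K \<in> sets borel" using K(1) by (simp add: borel_compact)
  then have "(\<lambda>x. complex_of_real (indicator K x)) \<in> borel_measurable borel" by measurable
  then have "(\<lambda>x. complex_of_real (indicator K x)) \<in> borel_measurable torus_measure"
    unfolding torus_measure_def
    by (intro measurable_restrict_space1 measurable_completion) simp
  then show sq: "square_integrable (\<lambda>x. complex_of_real (indicator K x))"
    by (rule square_integrable_bounded[where C = 1]) (auto simp: indicator_def)
  show "abs_L2 (\<lambda>x. complex_of_real (indicator K x)) \<in> trig_closure"
  \<comment> \<open>\<open>infdist\<close> to the empty set is 0, so the functions \<open>u\<close>
    below would be constantly 1 in that case.\<close>
  proof (cases "K = {}")
    case True
    then show ?thesis
      using trig_poly_span[OF trig_poly_const[of 0]] closure_subset by auto
  next
    case False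
    define C where "C = torus_embed ` K"
    have C: "closed C" "C \<noteq> {}"
      using False K(1) unfolding C_def
      by (auto intro!: compact_imp_closed compact_continuous_image continuous_on_torus_embed)
    \<comment> \<open>Each \<open>u n\<close> is 1 on \<open>C\<close> and, for
      \<open>n \<ge> 1\<close>, vanishes at distance \<open>1 / n\<close> or more from it.\<close>
    define u where "u = (\<lambda>n z. max 0 (1 - real n * infdist z C))"
    have u: "continuous_on UNIV (u n)" for n
      unfolding u_def by (intro continuous_intros)
    show ?thesis
    proof (rule trig_closure_dominated[OF continuous_in_trig_closure[OF u] sq square_integrable_const[of 1]])
      fix n and x :: "real ^ 's"
      have "0 \<le> real n * infdist (torus_embed x) C" by (simp add: infdist_nonneg)
      then show "cmod (complex_of_real (u n (torus_embed x))) \<le> cmod 1"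
        by (simp add: u_def)
    next
      fix x assume x: "x \<in> ?Q"
      show "(\<lambda>n. complex_of_real (u n (torus_embed x))) \<longlonglongrightarrow> complex_of_real (indicator K x)"
      proof (cases "x \<in> K")
        case True
        then have "infdist (torus_embed x) C = 0" by (simp add: C_def)
        then show ?thesis using True by (simp add: u_def)
      next
        case False
        then have "torus_embed x \<notin> C"
          using torus_embed_inj[OF _ x] K(2) unfolding C_def by (metis imageE subsetD)
        then have "0 < infdist (torus_embed x) C"
          using C in_closed_iff_infdist_zero[OF C] infdist_nonneg[of "torus_embed x" C] by fastforce
        then obtain N where "1 < real N * infdist (torus_embed x) C"
          using reals_Archimedean3 by blast
        have "u n (torus_embed x) = 0" if "n \<ge> N" for n
        proof -
          have "real N * infdist (torus_embed x) C \<le> real n * infdist (torus_embed x) C"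
            using that by (intro mult_right_mono) (auto simp: infdist_nonneg)
          then show ?thesis using \<open>1 < _\<close> by (simp add: u_def)
        qed
        then have "\<forall>\<^sub>F n in sequentially. complex_of_real (u n (torus_embed x)) = complex_of_real (indicator K x)"
          using False unfolding eventually_sequentially by auto
        then show ?thesis by (rule tendsto_eventually)
      qed
    qed
  qed
qed

text \<open>Inner regularity supplies a closed \<open>K\<close> filling almost all of
  \<open>A\<close> inside the open cube, and the faces of the cube are null. The squared distance of
  the two indicators is the measure of \<open>A - K\<close> up to normalisation.\<close>

lemma indicator_in_trig_closure:
  fixes A :: "(real ^ 's::finite) set"
  assumes A: "A \<in> sets torus_measure"
  shows "square_integrable (\<lambda>x. complex_of_real (indicator A x))"
    and "abs_L2 (\<lambda>x. complex_of_real (indicator A x)) \<in> trig_closure"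
proof -
  let ?Q = "cbox (\<chi> j. - pi) (\<chi> j. pi) :: (real ^ 's) set"
  let ?O = "box (\<chi> j. - pi) (\<chi> j. pi) :: (real ^ 's) set"
  have AQ: "A \<subseteq> ?Q" and AL: "A \<in> sets lebesgue"
    using A by (auto simp: torus_measure_def sets_restrict_space_iff)
  have "(\<lambda>x. complex_of_real (indicator A x)) \<in> borel_measurable torus_measure"
    using A by measurable
  then show sq: "square_integrable (\<lambda>x. complex_of_real (indicator A x))"
    by (rule square_integrable_bounded[where C = 1]) (auto simp: indicator_def)
  have "\<exists>h\<in>trig_closure. dist h (abs_L2 (\<lambda>x. complex_of_real (indicator A x))) < e" if e: "e > 0" for e
  proof -
    have "A \<inter> ?O \<in> sets lebesgue" using AL by auto
    \<comment> \<open>The distance is the square root of a measure, hence the tolerance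
      \<open>e^2\<close>.\<close>
    moreover have "e\<^sup>2 > 0" using e by simp
    ultimately obtain K where K: "closed K" "K \<subseteq> A \<inter> ?O" "emeasure lebesgue (A \<inter> ?O - K) < ennreal (e\<^sup>2)"
      by (rule sets_lebesgue_inner_closed)
    have "compact K"
      using K(1,2) bounded_subset[OF bounded_box] by (auto simp: compact_eq_bounded_closed)
    note Kc = indicator_compact_in_trig_closure[OF this, OF order_trans[OF K(2) Int_lower2]]
    have KL: "K \<in> sets lebesgue" using K(1) by simp
    have "negligible (?Q - ?O)" by (rule negligible_frontier_interval)
    then have null: "?Q - ?O \<in> null_sets lebesgue" by (simp add: negligible_iff_null_sets)
    have "emeasure lebesgue (A - K) \<le> emeasure lebesgue ((A \<inter> ?O - K) \<union> (?Q - ?O))"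
      using AQ AL KL by (intro emeasure_mono sets.Un sets.Diff sets.Int) auto
    also have "\<dots> = emeasure lebesgue (A \<inter> ?O - K)"
      using null AL KL by (intro emeasure_Un_null_set sets.Diff sets.Int) auto
    finally have small: "emeasure lebesgue (A - K) < ennreal (e\<^sup>2)" using K(3) by simp
    have AK: "A - K \<in> sets torus_measure"
      using AQ AL KL by (auto simp: torus_measure_def sets_restrict_space_iff)
    have "(norm (abs_L2 (\<lambda>x. complex_of_real (indicator K x)) - abs_L2 (\<lambda>x. complex_of_real (indicator A x))))\<^sup>2 =
        (\<integral>x. (cmod (complex_of_real (indicator K x) - complex_of_real (indicator A x)))\<^sup>2 \<partial>torus_measure) / (2 * pi) ^ CARD('s)"
      by (rule norm_abs_L2_diff[OF Kc(1) sq])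
    also have "(\<integral>x. (cmod (complex_of_real (indicator K x) - complex_of_real (indicator A x)))\<^sup>2 \<partial>torus_measure) =
        (\<integral>x. indicator (A - K) x \<partial>torus_measure)"
      using K(2) by (intro Bochner_Integration.integral_cong) (auto simp: indicator_def)
    also have "\<dots> = measure torus_measure (A - K)"
      using AK sets.sets_into_space[OF AK] by (simp add: Int_absorb2)
    also have "\<dots> = measure lebesgue (A - K)"
      unfolding torus_measure_def using AQ by (intro measure_restrict_space) auto
    also have "measure lebesgue (A - K) / (2 * pi) ^ CARD('s) < e\<^sup>2"
    proof -
      have "emeasure lebesgue (A - K) = ennreal (measure lebesgue (A - K))"
        using small by (intro emeasure_eq_ennreal_measure) auto
      then have "measure lebesgue (A - K) < e\<^sup>2"
        using small by (simp add: ennreal_less_iff)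
      \<comment> \<open>The normalising factor is at least 1, so dividing by it preserves the
        bound.\<close>
      moreover have "1 \<le> (2 * pi) ^ CARD('s)" using pi_ge_two by (intro one_le_power) simp
      then have "measure lebesgue (A - K) / (2 * pi) ^ CARD('s) \<le> measure lebesgue (A - K) / 1"
        by (intro divide_left_mono) auto
      ultimately show ?thesis by simp
    qed
    finally have "norm (abs_L2 (\<lambda>x. complex_of_real (indicator K x)) - abs_L2 (\<lambda>x. complex_of_real (indicator A x))) < e"
      using e by (simp add: power2_less_imp_less)
    then show ?thesis using Kc(2) by (auto simp: dist_norm)
  qed
  then have "abs_L2 (\<lambda>x. complex_of_real (indicator A x)) \<in> closure trig_closure"
    by (subst closure_approachable) auto
  then show "abs_L2 (\<lambda>x. complex_of_real (indicator A x)) \<in> trig_closure" by simp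
qed

text \<open>On the cube, \<open>f\<close> is a finite combination of the indicators of its level
  sets.\<close>

lemma simple_function_in_trig_closure:
  fixes f :: "real ^ 's::finite \<Rightarrow> complex"
  assumes f: "simple_function torus_measure f"
  shows "square_integrable f" "abs_L2 f \<in> trig_closure"
proof -
  define A where "A = (\<lambda>v. f -` {v} \<inter> space torus_measure)"
  have A: "A v \<in> sets torus_measure" for v
    unfolding A_def by (rule simple_functionD(2)[OF f])
  have "square_integrable (\<lambda>x. \<Sum>v\<in>V. v * complex_of_real (indicator (A v) x)) \<and>
      abs_L2 (\<lambda>x. \<Sum>v\<in>V. v * complex_of_real (indicator (A v) x)) \<in> trig_closure" if "finite V" for V
    using that
  proof (induction V)
    case empty
    show ?case
      using trig_poly_span[OF trig_poly_const[of 0]] closure_subset by auto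
  next
    case (insert v V)
    have v: "square_integrable (\<lambda>x. v * complex_of_real (indicator (A v) x))"
      by (intro square_integrable_scale indicator_in_trig_closure A)
    have "abs_L2 (\<lambda>x. v * complex_of_real (indicator (A v) x)) \<in> trig_closure"
      using trig_closure_scale[OF indicator_in_trig_closure(2)[OF A]]
      by (simp add: abs_L2_arith(3)[OF indicator_in_trig_closure(1)[OF A] square_integrable_zero])
    with insert v show ?case
      by (simp add: square_integrable_add trig_closure_add flip: abs_L2_arith(1))
  qed
  moreover have "finite (f ` space torus_measure)" by (rule simple_functionD(1)[OF f])
  ultimately have sum: "square_integrable (\<lambda>x. \<Sum>v\<in>f ` space torus_measure. v * complex_of_real (indicator (A v) x))"
    "abs_L2 (\<lambda>x. \<Sum>v\<in>f ` space torus_measure. v * complex_of_real (indicator (A v) x)) \<in> trig_closure"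
    by blast+
  have eq: "(\<Sum>v\<in>f ` space torus_measure. v * complex_of_real (indicator (A v) x)) = f x"
    if "x \<in> cbox (\<chi> j. - pi) (\<chi> j. pi)" for x
  proof -
    have x: "x \<in> space torus_measure" using that by (simp add: torus_measure_def)
    have "(\<Sum>v\<in>f ` space torus_measure. v * complex_of_real (indicator (A v) x)) =
        (\<Sum>v\<in>f ` space torus_measure. if v = f x then f x else 0)"
      using x by (intro sum.cong) (auto simp: A_def)
    then show ?thesis using x \<open>finite (f ` space torus_measure)\<close> by simp
  qed
  show "square_integrable f" "abs_L2 f \<in> trig_closure"
    using abs_L2_cong[OF sum(1) eq] sum(2) by simp_all
qed

text \<open>A representative is a pointwise limit of simple functions bounded by twice its modulus,
  which is square integrable and so dominates.\<close>

theorem trig_closure_UNIV: "trig_closure = (UNIV :: 's::finite L2 set)"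
proof -
  have "F \<in> trig_closure" for F :: "'s L2"
  proof -
    obtain f where f: "square_integrable f" "F = abs_L2 f" by (rule L2_cases)
    then have "f \<in> borel_measurable torus_measure" by (simp add: square_integrable_def)
    from borel_measurable_implies_sequence_metric[OF this, of 0]
    obtain s where s: "\<And>n. simple_function torus_measure (s n)"
      "\<And>x. x \<in> space torus_measure \<Longrightarrow> (\<lambda>n. s n x) \<longlonglongrightarrow> f x"
      "\<And>n x. x \<in> space torus_measure \<Longrightarrow> cmod (s n x) \<le> 2 * cmod (f x)"
      by simp metis
    have "abs_L2 f \<in> trig_closure"
      by (rule trig_closure_dominated[OF simple_function_in_trig_closure[OF s(1)] f(1)
            square_integrable_scale[OF f(1), of 2]])
        (use s(2,3) in \<open>auto simp: torus_measure_def norm_mult\<close>)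
    then show ?thesis using f(2) by simp
  qed
  then show ?thesis by auto
qed

section \<open>Comparing norms through Fourier coefficients\<close>

lemma trig_sum_add: "trig_sum S (\<lambda>k. c k + d k) = trig_sum S c + trig_sum S d"
  by (simp add: trig_sum_def L2.scale_left_distrib sum.distrib)

lemma trig_sum_diff: "trig_sum S (\<lambda>k. c k - d k) = trig_sum S c - trig_sum S d"
  by (simp add: trig_sum_def L2.scale_left_diff_distrib sum_subtractf)

lemma trig_sum_fourier_coeff_span:
  assumes "finite S" "p \<in> L2.span (L2_exp ` S)"
  shows "trig_sum S (fourier_coeff p) = p"
  using assms(2)
proof (induction rule: L2.span_induct_alt)
  case base
  show ?case by (simp add: trig_sum_def fourier_coeff_def)
next
  case (step c x y)
  then obtain l where l: "l \<in> S" "x = L2_exp l" by blast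
  have "trig_sum S (\<lambda>k. if k = l then c else 0) = (\<Sum>k\<in>S. if k = l then L2_scale c (L2_exp l) else 0)"
    unfolding trig_sum_def by (intro sum.cong) auto
  then have "trig_sum S (\<lambda>k. if k = l then c else 0) = L2_scale c x"
    using assms(1) l by simp
  moreover have "fourier_coeff (L2_scale c x + y) = (\<lambda>k. (if k = l then c else 0) + fourier_coeff y k)"
    by (auto simp: fourier_coeff_simps l(2))
  ultimately show ?case
    using step by (simp add: trig_sum_add)
qed

text \<open>A substitute for Parseval's identity. By density some finite partial sum of
  \<open>f\<close> leaves an arbitrarily small remainder; its norm is compared termwise with the
  coefficients of \<open>g\<close>, which Bessel controls. Taking \<open>C = 0\<close> gives
  uniqueness, and \<open>C = \<epsilon>\<close> the truncation error.\<close>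

lemma norm_le_of_fourier_coeff_le:
  fixes f g :: "'s::finite L2"
  assumes C: "0 \<le> C" and le: "\<And>k. cmod (fourier_coeff f k) \<le> C * cmod (fourier_coeff g k)"
  shows "norm f \<le> C * norm g"
proof -
  have "(norm f)\<^sup>2 \<le> (C * norm g)\<^sup>2 + e" if e: "0 < e" for e
  proof -
    have "f \<in> closure (L2.span (range L2_exp))" using trig_closure_UNIV by auto
    then obtain p where p: "p \<in> L2.span (range L2_exp)" "dist p f < sqrt e"
      using e unfolding closure_approachable by (meson real_sqrt_gt_zero)
    obtain t r where t: "finite t" "t \<subseteq> range L2_exp" "p = (\<Sum>a\<in>t. L2_scale (r a) a)"
      using p(1) unfolding L2.span_explicit by blast
    obtain S where S: "finite S" "t = L2_exp ` S"
      using finite_subset_image[OF t(1,2)] by blast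
    have "p \<in> L2.span (L2_exp ` S)"
      unfolding t(3) S(2)[symmetric] by (intro L2.span_sum L2.span_scale L2.span_base)
    then have Pp: "trig_sum S (fourier_coeff p) = p" by (rule trig_sum_fourier_coeff_span[OF S(1)])
    have "fourier_coeff (f - p) = (\<lambda>k. fourier_coeff f k - fourier_coeff p k)"
      by (simp add: fun_eq_iff fourier_coeff_simps)
    \<comment> \<open>As \<open>p\<close> is its own partial sum, subtracting it leaves the
      remainder unchanged; hence the partial sum of \<open>f\<close> approximates at least as well
      as \<open>p\<close>.\<close>
    then have res: "f - trig_sum S (fourier_coeff f) = (f - p) - trig_sum S (fourier_coeff (f - p))"
      by (simp add: trig_sum_diff Pp)
    have "(norm (f - trig_sum S (fourier_coeff f)))\<^sup>2 \<le> (norm (f - p))\<^sup>2"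
      unfolding res using norm_eq_residual[OF S(1), of "f - p"] by (simp add: sum_nonneg)
    also have "\<dots> \<le> (sqrt e)\<^sup>2"
      using p(2) by (intro power_mono) (auto simp: dist_norm norm_minus_commute)
    finally have "(norm (f - trig_sum S (fourier_coeff f)))\<^sup>2 \<le> e" using e by simp
    moreover have "(\<Sum>k\<in>S. (cmod (fourier_coeff f k))\<^sup>2) \<le> (\<Sum>k\<in>S. (C * cmod (fourier_coeff g k))\<^sup>2)"
      by (intro sum_mono power_mono le) auto
    moreover have "\<dots> \<le> (C * norm g)\<^sup>2"
      using mult_left_mono[OF Bessel[OF S(1), of g], of "C\<^sup>2"]
      by (simp add: power_mult_distrib sum_distrib_left)
    ultimately show ?thesis
      using norm_eq_residual[OF S(1), of f] by simp
  qed
  then have "(norm f)\<^sup>2 \<le> (C * norm g)\<^sup>2" by (rule field_le_epsilon)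
  then show ?thesis by (rule power2_le_imp_le) (simp add: C)
qed

subsection \<open>Widths of the Korobov ball\<close>

lemma korobov_weight_pos: "0 < a \<Longrightarrow> 0 < korobov_weight a k"
  unfolding korobov_weight_def by (intro prod_pos) auto

text \<open>The weights are positive, so all coefficients of \<open>g - h\<close> vanish and
  completeness applies. This gives the \<open>THE\<close> in \<open>korobov_norm\<close> its
  meaning.\<close>

lemma korobov_convolution_unique:
  assumes "0 < a" "korobov_convolution r a f g" "korobov_convolution r a f h"
  shows "g = h"
proof -
  have "fourier_coeff g k = fourier_coeff h k" for k
  proof -
    have "of_real (korobov_weight a k powr - r) * fourier_coeff g k =
        of_real (korobov_weight a k powr - r) * fourier_coeff h k"
      using assms(2,3) by (simp add: korobov_convolution_def)
    then show ?thesis using korobov_weight_pos[OF assms(1), of k] by simp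
  qed
  then have "norm (g - h) \<le> 0 * norm g"
    by (intro norm_le_of_fourier_coeff_le) (simp_all add: fourier_coeff_simps)
  then show ?thesis by simp
qed

lemma korobov_ball_eq:
  assumes "0 < a"
  shows "korobov_ball r a = {f :: 's::finite L2. \<exists>g. korobov_convolution r a f g \<and> norm g \<le> 1}"
proof -
  have "korobov_norm r a f = norm g" if "korobov_convolution r a f g" for f g :: "'s L2"
    unfolding korobov_norm_def
    using that korobov_convolution_unique[OF assms] by (metis the_equality)
  then show ?thesis
    unfolding korobov_ball_def korobov_space_def by auto
qed

text \<open>Gaussian elimination by induction on the equations, indexed by \<open>B\<close>; the
  unknowns are indexed by \<open>S\<close>.\<close>

lemma underdetermined_system:
  fixes \<phi> :: "'b \<Rightarrow> 'k \<Rightarrow> 'c::field"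
  assumes "finite B" "finite S" "card B < card S"
  shows "\<exists>c. (\<exists>k\<in>S. c k \<noteq> 0) \<and> (\<forall>b\<in>B. (\<Sum>k\<in>S. c k * \<phi> b k) = 0)"
  using assms
proof (induction B arbitrary: S \<phi>)
  case empty
  then have "S \<noteq> {}" by auto
  then show ?case by (intro exI[of _ "\<lambda>_. 1"]) auto
next
  case (insert b B)
  show ?case
  proof (cases "\<forall>k\<in>S. \<phi> b k = 0")
    case True
    obtain c where "\<exists>k\<in>S. c k \<noteq> 0" "\<forall>b\<in>B. (\<Sum>k\<in>S. c k * \<phi> b k) = 0"
      using insert.IH[of S \<phi>] insert.prems insert.hyps by auto
    then show ?thesis using True by (intro exI[of _ c]) auto
  next
    case False
    then obtain l where l: "l \<in> S" "\<phi> b l \<noteq> 0" by blast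
    \<comment> \<open>The coefficients that remain after equation \<open>b\<close> has been solved
      for the unknown \<open>l\<close>.\<close>
    define \<psi> where "\<psi> = (\<lambda>b' k. \<phi> b' k - \<phi> b' l * (\<phi> b k / \<phi> b l))"
    have "card B < card (S - {l})"
      using insert.prems insert.hyps l by simp
    then obtain c where c: "\<exists>k\<in>S - {l}. c k \<noteq> 0" "\<forall>b'\<in>B. (\<Sum>k\<in>S - {l}. c k * \<psi> b' k) = 0"
      using insert.IH[of "S - {l}" \<psi>] insert.prems by auto
    \<comment> \<open>The value at \<open>l\<close> is the one that satisfies equation
      \<open>b\<close>; every other equation then reduces to its eliminated form.\<close>
    define d where "d = c(l := - (\<Sum>k\<in>S - {l}. c k * \<phi> b k) / \<phi> b l)"
    have d: "(\<Sum>k\<in>S. d k * \<phi> b' k) = (\<Sum>k\<in>S - {l}. c k * \<psi> b' k)" for b'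
    proof -
      have "(\<Sum>k\<in>S - {l}. d k * \<phi> b' k) = (\<Sum>k\<in>S - {l}. c k * \<phi> b' k)"
        by (intro sum.cong) (auto simp: d_def)
      moreover have "(\<Sum>k\<in>S - {l}. c k * \<psi> b' k) =
          (\<Sum>k\<in>S - {l}. c k * \<phi> b' k) - \<phi> b' l / \<phi> b l * (\<Sum>k\<in>S - {l}. c k * \<phi> b k)"
        by (simp add: \<psi>_def right_diff_distrib sum_subtractf sum_distrib_left mult_ac)
      ultimately show ?thesis
        using sum.remove[OF insert.prems(1) l(1), of "\<lambda>k. d k * \<phi> b' k"] by (simp add: d_def)
    qed
    have "(\<Sum>k\<in>S - {l}. c k * \<psi> b k) = 0" using l by (simp add: \<psi>_def)
    then have "\<forall>b'\<in>insert b B. (\<Sum>k\<in>S. d k * \<phi> b' k) = 0" using c(2) by (simp add: d)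
    moreover have "\<exists>k\<in>S. d k \<noteq> 0" using c(1) by (auto simp: d_def)
    ultimately show ?thesis by blast
  qed
qed

text \<open>The subspace is spanned by the exponentials with frequencies in \<open>S\<close>.
  Outside \<open>S\<close> the factor \<open>korobov_weight a k powr (- r)\<close> is at most
  \<open>\<epsilon>\<close>, so the coefficients of the remainder are at most
  \<open>\<epsilon>\<close> times those of \<open>g\<close>.\<close>

lemma n_eps_korobov_ball_le:
  fixes r a \<epsilon> :: real and S :: "(int ^ 's::finite) set"
  assumes "0 < r" "0 < a" "0 < \<epsilon>"
    and S: "S = {k. korobov_weight a k < \<epsilon> powr (- 1 / r)}" and fin: "finite S"
  shows "n_eps L2_scale \<epsilon> (korobov_ball r a :: 's L2 set) \<le> enat (card S)"
proof -
  have "(INF p\<in>L2.span (L2_exp ` S). ennreal (norm (f - p))) \<le> ennreal \<epsilon>"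
    if f: "f \<in> korobov_ball r a" for f :: "'s L2"
  proof -
    obtain g where g: "korobov_convolution r a f g" "norm g \<le> 1"
      using f by (auto simp: korobov_ball_eq[OF assms(2)])
    define p where "p = trig_sum S (fourier_coeff f)"
    have "cmod (fourier_coeff (f - p) k) \<le> \<epsilon> * cmod (fourier_coeff g k)" for k
    proof (cases "k \<in> S")
      case True
      then show ?thesis
        using assms(3) by (simp add: fourier_coeff_simps p_def fourier_coeff_trig_sum[OF fin])
    next
      case False
      then have "\<epsilon> powr (- 1 / r) \<le> korobov_weight a k" by (simp add: S)
      then have "korobov_weight a k powr (- r) \<le> (\<epsilon> powr (- 1 / r)) powr (- r)"
        using assms by (intro powr_mono2') auto
      also have "\<dots> = \<epsilon>" using assms by (simp add: powr_powr)
      finally have "korobov_weight a k powr (- r) * cmod (fourier_coeff g k) \<le> \<epsilon> * cmod (fourier_coeff g k)"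
        by (intro mult_right_mono) auto
      moreover have "fourier_coeff (f - p) k = of_real (korobov_weight a k powr (- r)) * fourier_coeff g k"
        using False g(1)
        by (simp add: fourier_coeff_simps p_def fourier_coeff_trig_sum[OF fin] korobov_convolution_def)
      ultimately show ?thesis by (simp add: norm_mult)
    qed
    then have "norm (f - p) \<le> \<epsilon> * norm g"
      using assms by (intro norm_le_of_fourier_coeff_le) auto
    also have "\<dots> \<le> \<epsilon> * 1" using g(2) assms by (intro mult_left_mono) auto
    finally have "norm (f - p) \<le> \<epsilon>" by simp
    then show ?thesis
      by (intro INF_lower2[of p]) (auto simp: p_def trig_sum_in_span ennreal_leI)
  qed
  then have "(SUP f\<in>korobov_ball r a. INF p\<in>L2.span (L2_exp ` S). ennreal (norm (f - p :: 's L2))) \<le> ennreal \<epsilon>"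
    by (rule SUP_least)
  then show ?thesis
    unfolding n_eps_def using fin card_image_le[OF fin, of L2_exp]
    by (intro Inf_lower) blast
qed

text \<open>If \<open>B\<close> has fewer elements than \<open>S\<close>, some nonzero trigonometric
  polynomial with frequencies in \<open>S\<close> is orthogonal to the span of \<open>B\<close>, so
  its distance from that span is its own norm. The strict inequality defining \<open>S\<close> makes
  this norm exceed \<open>\<epsilon>\<close> after scaling into the ball.\<close>

lemma n_eps_korobov_ball_ge:
  fixes r a \<epsilon> :: real and S :: "(int ^ 's::finite) set"
  assumes "0 < r" "0 < a" "0 < \<epsilon>"
    and S: "S = {k. korobov_weight a k < \<epsilon> powr (- 1 / r)}" and fin: "finite S"
  shows "enat (card S) \<le> n_eps L2_scale \<epsilon> (korobov_ball r a :: 's L2 set)"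
  unfolding n_eps_def
proof (rule Inf_greatest, clarify)
  fix n and B :: "'s L2 set"
  assume B: "finite B" "card B \<le> n"
    and sup: "(SUP f\<in>korobov_ball r a. INF p\<in>L2.span B. ennreal (norm (f - p))) \<le> ennreal \<epsilon>"
  show "enat (card S) \<le> enat n"
  proof (rule ccontr)
    assume "\<not> enat (card S) \<le> enat n"
    then have "card B < card S" using B(2) by simp
    \<comment> \<open>The unknowns are the coefficients of the polynomial; each \<open>b\<close>
      gives one equation, orthogonality to \<open>b\<close>.\<close>
    from underdetermined_system[OF B(1) fin this, of "\<lambda>b k. L2_cinner (L2_exp k) b"]
    obtain c where c: "\<exists>k\<in>S. c k \<noteq> 0" "\<forall>b\<in>B. (\<Sum>k\<in>S. c k * L2_cinner (L2_exp k) b) = 0"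
      by blast
    define w where "w = (\<lambda>k :: int ^ 's. korobov_weight a k powr r)"
    have w: "0 < w k" for k using korobov_weight_pos[OF assms(2), of k] by (simp add: w_def)
    have w_less: "\<epsilon> * w k < 1" if "k \<in> S" for k
    proof -
      have "w k < (\<epsilon> powr (- 1 / r)) powr r"
        unfolding w_def using that[unfolded S] assms(1,2) less_imp_le[OF korobov_weight_pos[OF assms(2), of k]]
        by (intro powr_less_mono2) auto
      also have "\<dots> = 1 / \<epsilon>" using assms(1,3) by (subst powr_powr) (simp add: powr_minus_divide)
      finally show ?thesis using assms(3) by (simp add: pos_less_divide_eq mult.commute)
    qed
    define f where "f = trig_sum S c"
    \<comment> \<open>The preimage of \<open>f\<close> under the convolution: \<open>w k\<close> is
      the reciprocal of the factor at frequency \<open>k\<close>.\<close>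
    define g where "g = trig_sum S (\<lambda>k. c k * of_real (w k))"
    have nf: "(norm f)\<^sup>2 = (\<Sum>k\<in>S. (cmod (c k))\<^sup>2)"
      unfolding f_def by (rule norm_trig_sum[OF fin])
    have ng: "(norm g)\<^sup>2 = (\<Sum>k\<in>S. (cmod (c k))\<^sup>2 * (w k)\<^sup>2)"
      unfolding g_def norm_trig_sum[OF fin] by (simp add: norm_mult power_mult_distrib)
    have conv: "korobov_convolution r a (L2_scale d f) (L2_scale d g)" for d
      unfolding korobov_convolution_def
    proof
      fix k :: "int ^ 's"
      have "korobov_weight a k powr (- r) * w k = 1"
        using korobov_weight_pos[OF assms(2), of k] by (simp add: w_def flip: powr_add)
      then have "complex_of_real (korobov_weight a k powr (- r)) * of_real (w k) = 1"
        by (metis of_real_1 of_real_mult)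
      then show "fourier_coeff (L2_scale d f) k =
          of_real (korobov_weight a k powr (- r)) * fourier_coeff (L2_scale d g) k"
        by (simp add: fourier_coeff_simps f_def g_def fourier_coeff_trig_sum[OF fin] mult_ac)
    qed
    \<comment> \<open>All factors \<open>\<epsilon> * w k\<close> are below 1 and some
      \<open>c k\<close> is nonzero, so the inequality of the sums is strict.\<close>
    have "(\<Sum>k\<in>S. (cmod (c k))\<^sup>2 * (\<epsilon> * w k)\<^sup>2) < (\<Sum>k\<in>S. (cmod (c k))\<^sup>2)"
    proof (rule sum_strict_mono_ex1[OF fin])
      have sq: "(\<epsilon> * w k)\<^sup>2 < 1" if "k \<in> S" for k
        using w_less[OF that] w[of k] assms(3) by (simp add: power_less_one_iff)
      show "\<forall>k\<in>S. (cmod (c k))\<^sup>2 * (\<epsilon> * w k)\<^sup>2 \<le> (cmod (c k))\<^sup>2"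
        using sq by (intro ballI mult_right_le_one_le) (auto intro: less_imp_le)
      obtain k where "k \<in> S" "c k \<noteq> 0" using c(1) by blast
      then have "(cmod (c k))\<^sup>2 * (\<epsilon> * w k)\<^sup>2 < (cmod (c k))\<^sup>2 * 1"
        using sq by (intro mult_strict_left_mono) auto
      then show "\<exists>k\<in>S. (cmod (c k))\<^sup>2 * (\<epsilon> * w k)\<^sup>2 < (cmod (c k))\<^sup>2"
        using \<open>k \<in> S\<close> by (intro bexI[of _ k]) simp_all
    qed
    then have "(\<epsilon> * norm g)\<^sup>2 < (norm f)\<^sup>2"
      by (simp add: nf ng power_mult_distrib sum_distrib_left mult_ac)
    then have less: "\<epsilon> * norm g < norm f" by (simp add: power2_less_imp_less)
    have "norm g \<noteq> 0"
    proof
      assume "norm g = 0"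
      then have "(\<Sum>k\<in>S. (cmod (c k))\<^sup>2 * (w k)\<^sup>2) = 0" using ng by simp
      then have "\<forall>k\<in>S. (cmod (c k))\<^sup>2 * (w k)\<^sup>2 = 0"
        using fin by (subst (asm) sum_nonneg_eq_0_iff) auto
      then show False using c(1) w by (metis less_irrefl mult_eq_0_iff norm_eq_zero power_eq_0_iff)
    qed
    \<comment> \<open>This factor scales the preimage \<open>g\<close> to norm 1, the largest that
      the ball allows.\<close>
    define d where "d = complex_of_real (1 / norm g)"
    have cd: "cmod d = 1 / norm g" by (simp add: d_def norm_divide)
    have ball: "L2_scale d f \<in> korobov_ball r a"
      unfolding korobov_ball_eq[OF assms(2)]
      using conv[of d] \<open>norm g \<noteq> 0\<close> by (auto simp: norm_L2_scale cd)
    have orth: "L2_cinner f p = 0" if "p \<in> L2.span B" for p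
      using that
    proof (induction rule: L2.span_induct_alt)
      case base
      show ?case by simp
    next
      case (step e x y)
      have "L2_cinner f x = (\<Sum>k\<in>S. c k * L2_cinner (L2_exp k) x)"
        by (simp add: f_def trig_sum_def L2_cinner_sum_left L2_cinner_scale_left)
      then show ?case
        using c(2) step by (simp add: L2_cinner_add_right L2_cinner_scale_right)
    qed
    have "ennreal (norm (L2_scale d f)) \<le> (INF p\<in>L2.span B. ennreal (norm (L2_scale d f - p)))"
    proof (intro INF_greatest ennreal_leI)
      fix p assume "p \<in> L2.span B"
      then have "L2_cinner (L2_scale d f) (- p) = 0"
        using orth[OF L2.span_neg] by (simp add: L2_cinner_scale_left)
      from norm_add_orthogonal[OF this]
      have "(norm (L2_scale d f))\<^sup>2 \<le> (norm (L2_scale d f - p))\<^sup>2" by simp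
      then show "norm (L2_scale d f) \<le> norm (L2_scale d f - p)" by (rule power2_le_imp_le) simp
    qed
    also have "\<dots> \<le> ennreal \<epsilon>"
      using ball sup by (meson SUP_upper order_trans)
    finally have "norm (L2_scale d f) \<le> \<epsilon>" using assms(3) by simp
    moreover have "\<epsilon> < norm (L2_scale d f)"
      using less \<open>norm g \<noteq> 0\<close> by (simp add: norm_L2_scale cd pos_less_divide_eq)
    ultimately show False by simp
  qed
qed

section \<open>From lattice points to the explicit bounds\<close>

lemma emeasure_korobov_weight:
  "emeasure (count_space UNIV) {k :: int ^ 's::finite. korobov_weight a k < T} =
    emeasure (count_space UNIV) (hyp_cross a (UNIV :: 's set) T)"
proof -
  have "bij_betw vec_nth {k :: int ^ 's. korobov_weight a k < T} (hyp_cross a UNIV T)"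
    by (rule bij_betw_byWitness[of _ vec_lambda])
      (auto simp: korobov_weight_def hyp_cross_def)
  then show ?thesis
    by (simp add: emeasure_count_space bij_betw_finite bij_betw_same_card)
qed

text \<open>The last identity absorbs the power of \<open>b\<close> into the exponential, which
  leaves the factor \<open>2 ^ n * T\<close> of the final bounds.\<close>

lemma hyp_volume_eq:
  assumes "0 < b" "b ^ n < T"
  shows "0 < ln T - real n * ln b"
    and "hyp_volume b n T = (2 * b) ^ n * hyp_integral n (ln T - real n * ln b)"
    and "(2 * b) ^ n * exp (ln T - real n * ln b) = 2 ^ n * T"
proof -
  have bn: "0 < b ^ n" using assms(1) by simp
  then have T: "0 < T" using assms(2) by linarith
  have l: "ln (b ^ n) = real n * ln b" using assms(1) by (simp add: ln_realpow)
  have "ln (b ^ n) < ln T" using bn T assms(2) by simp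
  then show "0 < ln T - real n * ln b" by (simp add: l)
  show "hyp_volume b n T = (2 * b) ^ n * hyp_integral n (ln T - real n * ln b)"
    using assms by (simp add: hyp_volume_def)
  have "exp (ln T - real n * ln b) = T / b ^ n"
    unfolding l[symmetric] using bn T by (simp add: exp_diff)
  then show "(2 * b) ^ n * exp (ln T - real n * ln b) = 2 ^ n * T"
    using assms(1) by (simp add: power_mult_distrib)
qed

text \<open>The exponent \<open>- 1 / r\<close> is negative, so the upper limit on
  \<open>\<epsilon>\<close> becomes the condition \<open>b ^ n < T\<close> under which
  \<open>hyp_volume\<close> is given by its integral formula.\<close>

lemma power_less_powr_inverse:
  fixes b r \<epsilon> :: real
  assumes "0 < b" "0 < r" "0 < \<epsilon>" "\<epsilon> < b powr (- (real n * r))"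
  shows "b ^ n < \<epsilon> powr (- 1 / r)"
proof -
  have "b ^ n = (b powr (- (real n * r))) powr (- 1 / r)"
    using assms by (simp add: powr_powr powr_realpow)
  also have "\<dots> < \<epsilon> powr (- 1 / r)"
    using assms by (intro powr_less_mono2_neg) auto
  finally show ?thesis .
qed

theorem theorem5p4:
  fixes r a :: real and s :: nat
  assumes "r > 0" and "s = CARD('s::finite)" and "s \<ge> 2" and "a > 1/2"
  shows "(\<forall>\<epsilon>::real. 0 < \<epsilon> \<and> \<epsilon> < (a - 1/2) powr (- (real s * r)) \<longrightarrow>
            ereal_of_enat (n_eps L2_scale \<epsilon> (korobov_ball r a :: 's L2 set)) \<le> ereal (
              2 ^ s * \<epsilon> powr (- 1 / r) * (ln (\<epsilon> powr (- 1 / r)) - real s * ln (a - 1/2)) ^ s /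
              (fact (s - 1) * (ln (\<epsilon> powr (- 1 / r)) + real s * (1 - ln (a - 1/2)) - 1)))) \<and>
         (\<forall>\<epsilon>::real. 0 < \<epsilon> \<and> \<epsilon> < (a + 1/2) powr (- (real s * r)) \<longrightarrow>
            ereal_of_enat (n_eps L2_scale \<epsilon> (korobov_ball r a :: 's L2 set)) \<ge> ereal (
              2 ^ s * \<epsilon> powr (- 1 / r) * (ln (\<epsilon> powr (- 1 / r)) - real s * ln (a + 1/2)) ^ s /
              (fact (s - 1) * (ln (\<epsilon> powr (- 1 / r)) + real s * (1 - ln (a + 1/2)))) - 1))"
proof (intro conjI allI impI; elim conjE)
  have a: "0 < a" "0 < a - 1/2" "0 < a + 1/2" using assms(4) by auto
  define S where "S = (\<lambda>T. {k :: int ^ 's. korobov_weight a k < T})"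
  have upper: "emeasure (count_space UNIV) (S T) \<le> ennreal (hyp_volume (a - 1/2) s T)" for T
    unfolding S_def emeasure_korobov_weight
    using emeasure_hyp_cross_upper[of "UNIV :: 's set" a T] assms(2,4) by simp
  \<comment> \<open>An infinite set would have infinite counting measure, against the volume
    bound.\<close>
  have fin: "finite (S T)" for T
    using upper[of T] ennreal_less_top[of "hyp_volume (a - 1/2) s T"]
    by (intro ccontr[of "finite (S T)"]) (simp add: emeasure_count_space top_unique)
  have n_eps: "n_eps L2_scale \<epsilon> (korobov_ball r a :: 's L2 set) = enat (card (S (\<epsilon> powr (- 1 / r))))"
    if "0 < \<epsilon>" for \<epsilon>
    using n_eps_korobov_ball_le[OF assms(1) a(1) that _ fin] n_eps_korobov_ball_ge[OF assms(1) a(1) that _ fin]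
    by (intro antisym) (simp_all add: S_def)
  {
    fix \<epsilon> :: real
    assume \<epsilon>: "0 < \<epsilon>" "\<epsilon> < (a - 1/2) powr (- (real s * r))"
    define T where "T = \<epsilon> powr (- 1 / r)"
    define \<tau> where "\<tau> = ln T - real s * ln (a - 1/2)"
    have "(a - 1/2) ^ s < T"
      unfolding T_def by (rule power_less_powr_inverse[OF a(2) assms(1) \<epsilon>])
    note vol = hyp_volume_eq[OF a(2) this, folded \<tau>_def]
    \<comment> \<open>\<open>ennreal\<close> sends negative reals to 0, so nonnegativity is what
      allows the return to an inequality between reals.\<close>
    have "0 \<le> hyp_volume (a - 1/2) s T"
      unfolding vol(2) using vol(1) a(2) by (intro mult_nonneg_nonneg hyp_integral_nonneg) auto
    then have "real (card (S T)) \<le> hyp_volume (a - 1/2) s T"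
      using upper[of T] fin[of T] by (simp add: ennreal_of_nat_eq_real_of_nat)
    also have "\<dots> \<le> (2 * (a - 1/2)) ^ s * (exp \<tau> * \<tau> ^ s / (fact (s - 1) * (\<tau> + real s - 1)))"
      unfolding vol(2) using vol(1) a(2) assms(3) by (intro mult_left_mono hyp_integral_upper) auto
    also have "\<dots> = 2 ^ s * T * \<tau> ^ s / (fact (s - 1) * (\<tau> + real s - 1))"
      unfolding vol(3)[symmetric] by simp
    also have "\<tau> + real s - 1 = ln T + real s * (1 - ln (a - 1/2)) - 1"
      by (simp add: \<tau>_def algebra_simps)
    finally show "ereal_of_enat (n_eps L2_scale \<epsilon> (korobov_ball r a :: 's L2 set)) \<le> ereal (
        2 ^ s * \<epsilon> powr (- 1 / r) * (ln (\<epsilon> powr (- 1 / r)) - real s * ln (a - 1/2)) ^ s /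
        (fact (s - 1) * (ln (\<epsilon> powr (- 1 / r)) + real s * (1 - ln (a - 1/2)) - 1)))"
      unfolding n_eps[OF \<epsilon>(1)] \<tau>_def T_def by simp
  next
    fix \<epsilon> :: real
    assume \<epsilon>: "0 < \<epsilon>" "\<epsilon> < (a + 1/2) powr (- (real s * r))"
    define T where "T = \<epsilon> powr (- 1 / r)"
    define \<tau> where "\<tau> = ln T - real s * ln (a + 1/2)"
    have T: "0 < T" using \<epsilon>(1) by (simp add: T_def)
    have "(a + 1/2) ^ s < T"
      unfolding T_def by (rule power_less_powr_inverse[OF a(3) assms(1) \<epsilon>])
    note vol = hyp_volume_eq[OF a(3) this, folded \<tau>_def]
    have "ln T + real s * (1 - ln (a + 1/2)) = \<tau> + real s"
      by (simp add: \<tau>_def algebra_simps)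
    then have "2 ^ s * T * \<tau> ^ s / (fact (s - 1) * (ln T + real s * (1 - ln (a + 1/2)))) =
        (2 * (a + 1/2)) ^ s * (exp \<tau> * \<tau> ^ s / (fact (s - 1) * (\<tau> + real s)))"
      unfolding vol(3)[symmetric] by simp
    also have "\<dots> \<le> hyp_volume (a + 1/2) s T"
      unfolding vol(2) using vol(1) a(3) assms(3) by (intro mult_left_mono hyp_integral_lower) auto
    also have "\<dots> \<le> real (card (S T))"
    proof -
      have "ennreal (hyp_volume (a + 1/2) s T) \<le> emeasure (count_space UNIV) (S T)"
        unfolding S_def emeasure_korobov_weight
        using emeasure_hyp_cross_lower[of "UNIV :: 's set" a T] assms(2) a(1) T by simp
      then show ?thesis using fin[of T] by (simp add: ennreal_of_nat_eq_real_of_nat)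
    qed
    finally show "ereal (
        2 ^ s * \<epsilon> powr (- 1 / r) * (ln (\<epsilon> powr (- 1 / r)) - real s * ln (a + 1/2)) ^ s /
        (fact (s - 1) * (ln (\<epsilon> powr (- 1 / r)) + real s * (1 - ln (a + 1/2)))) - 1) \<le>
        ereal_of_enat (n_eps L2_scale \<epsilon> (korobov_ball r a :: 's L2 set))"
      unfolding n_eps[OF \<epsilon>(1)] \<tau>_def T_def by simp
  }
qed

end
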